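(* Let $(E,\|\cdot\|_E)\subset c_0$ be a Banach symmetric sequence space with the Fatou property, $E\neq l_2$, and let $V$ be a surjective 2-local isometry on the Banach symmetric ideal $(\mathcal C_E,\|\cdot\|_{\mathcal C_E})$ of compact operators on $\mathcal H$. Then $V$ is a linear isometry on $\mathcal C_E$.
   Context: $\mathcal H$ is a complex separable infinite-dimensional Hilbert space. $c_0\subset l_\infty$ denote the spaces of real sequences converging to zero, respectively bounded, with the sup norm. For $x=\{\xi_n\}\in l_\infty$ the non-increasing rearrangement is $x^*=\{\xi_n^*\}$, $\xi_n^*=\inf_{|F|<n}\sup_{k\notin F}|\xi_k|$, with $F$ ranging over finite subsets of $\mathbb N$. A Banach symmetric sequence space is a non-zero real linear subspace $E\subset l_\infty$ with a complete norm $\|\cdot\|_E$ such that $y\in E$, $x\in l_\infty$, $x^*\le y^*$ imply $x\in E$ and $\|x\|_E\le\|y\|_E$; the norm is normalized by $\|(1,0,0,\dots)\|_E=1$. $E$ has the Fatou property if whenever $0\le a_k\le a_{k+1}$, $a_k\in E$ for all $k$ (coordinatewise order) and $\sup_k\|a_k\|_E<\infty$, there is $a\in E$ with $a_k\uparrow a$ and $\|a\|_E=\sup_k\|a_k\|_E$. For $E\subset c_0$, $\mathcal C_E$ is the complex Banach space (a two-sided ideal of the bounded operators on $\mathcal H$) of all compact linear operators $x$ on $\mathcal H$ whose singular value sequence $\{s_n(x)\}_{n\ge1}$ (eigenvalues of $(x^*x)^{1/2}$ in decreasing order, with multiplicity) belongs to $E$, with norm $\|x\|_{\mathcal C_E}=\|\{s_n(x)\}\|_E$.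 The condition $E\ne l_2$ is understood for normed spaces: $(E,\|\cdot\|_E)$ is not $l_2$ with its usual norm, i.e. $\mathcal C_E$ is not the Hilbert–Schmidt ideal $\mathcal C_2$ with its Hilbert–Schmidt norm. For a complex Banach space $X$, a surjective 2-local isometry on $X$ is a surjective (not necessarily linear) mapping $T:X\to X$ such that for any $x,y\in X$ there is a surjective linear isometry $V_{x,y}$ on $X$ with $T(x)=V_{x,y}(x)$ and $T(y)=V_{x,y}(y)$. *)

theory Defs
  imports "HOL-Analysis.Analysis"
begin

section \<open>Complex Hilbert spaces\<close>

text \<open>
  The inner product is linear in the first argument. Positive definiteness of the inner product
  follows from \<open>norm_eq_sqrt_cinner\<close>, since \<open>norm\<close> is a norm and
  \<^const>\<open>sqrt\<close> is an odd injective function; completeness comes from \<^class>\<open>banach\<close>.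
\<close>

class complex_hilbert = banach +
  fixes scaleC :: "complex \<Rightarrow> 'a \<Rightarrow> 'a" (infixr \<open>*\<^sub>C\<close> 75)
    and cinner :: "'a \<Rightarrow> 'a \<Rightarrow> complex"
  assumes scaleC_add_right: "a *\<^sub>C (x + y) = a *\<^sub>C x + a *\<^sub>C y"
    and scaleC_add_left: "(a + b) *\<^sub>C x = a *\<^sub>C x + b *\<^sub>C x"
    and scaleC_scaleC: "a *\<^sub>C (b *\<^sub>C x) = (a * b) *\<^sub>C x"
    and scaleC_of_real: "complex_of_real r *\<^sub>C x = r *\<^sub>R x"
    and cinner_commute: "cinner x y = cnj (cinner y x)"
    and cinner_add_left: "cinner (x + y) z = cinner x z + cinner y z"
    and cinner_scaleC_left: "cinner (a *\<^sub>C x) y = a * cinner x y"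
    and norm_eq_sqrt_cinner: "norm x = sqrt (Re (cinner x x))"

instantiation complex :: complex_hilbert
begin

definition scaleC_complex :: "complex \<Rightarrow> complex \<Rightarrow> complex"
  where "scaleC_complex a x = a * x"

definition cinner_complex :: "complex \<Rightarrow> complex \<Rightarrow> complex"
  where "cinner_complex x y = x * cnj y"

instance
  by standard
    (simp_all add: scaleC_complex_def cinner_complex_def algebra_simps scaleR_conv_of_real
      norm_complex_def power2_eq_square)

end

global_interpretation complex_vector: vector_space "scaleC :: complex \<Rightarrow> 'a \<Rightarrow> 'a::complex_hilbert"
proof
  show "1 *\<^sub>C x = x" for x :: 'a
    using scaleC_of_real[of 1 x] by simp
qed (simp_all add: scaleC_add_right scaleC_add_left scaleC_scaleC)

abbreviation clinear :: "('a::complex_hilbert \<Rightarrow> 'a) \<Rightarrow> bool"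
  where "clinear \<equiv> Vector_Spaces.linear scaleC scaleC"


section \<open>Operators and singular values\<close>

definition bounded_clinear :: "('a::complex_hilbert \<Rightarrow> 'a) \<Rightarrow> bool"
  where "bounded_clinear x \<longleftrightarrow> bounded_linear x \<and> clinear x"

definition compact_clinear :: "('a::complex_hilbert \<Rightarrow> 'a) \<Rightarrow> bool"
  where "compact_clinear x \<longleftrightarrow> clinear x \<and> compact (closure (x ` cball 0 1))"

definition cadjoint :: "('a::complex_hilbert \<Rightarrow> 'a) \<Rightarrow> ('a \<Rightarrow> 'a)"
  where "cadjoint x = (THE y. \<forall>u v. cinner (x u) v = cinner u (y v))"

definition positive_op :: "('a::complex_hilbert \<Rightarrow> 'a) \<Rightarrow> bool"
  where "positive_op p \<longleftrightarrow> bounded_clinear p \<and> (\<forall>u. cinner (p u) u \<in> \<real>\<^sub>\<ge>\<^sub>0)"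

definition sqrt_op :: "('a::complex_hilbert \<Rightarrow> 'a) \<Rightarrow> ('a \<Rightarrow> 'a)"
  where "sqrt_op q = (THE p. positive_op p \<and> p \<circ> p = q)"

definition abs_op :: "('a::complex_hilbert \<Rightarrow> 'a) \<Rightarrow> ('a \<Rightarrow> 'a)"
  where "abs_op x = sqrt_op (cadjoint x \<circ> x)"

definition eigenspace :: "('a::complex_hilbert \<Rightarrow> 'a) \<Rightarrow> complex \<Rightarrow> 'a set"
  where "eigenspace p c = {u. p u = c *\<^sub>C u}"

text \<open>
  Sequences are indexed from \<open>0\<close>. The singular values are the decreasing sequence that lists
  each positive eigenvalue of \<open>abs_op x\<close> as often as its multiplicity, padded with zeros when
  there are only finitely many positive eigenvalues. For compact \<open>x\<close> this determines the sequence.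
\<close>

definition singular_values :: "('a::complex_hilbert \<Rightarrow> 'a) \<Rightarrow> nat \<Rightarrow> real"
  where "singular_values x = (THE s. decseq s \<and> (\<forall>n. 0 \<le> s n) \<and>
    (\<forall>t>0. finite {n. s n = t} \<and>
       card {n. s n = t} = complex_vector.dim (eigenspace (abs_op x) (complex_of_real t))))"


section \<open>Symmetric sequence spaces\<close>

definition l_infty :: "(nat \<Rightarrow> real) set"
  where "l_infty = {x. Bseq x}"

definition c_zero :: "(nat \<Rightarrow> real) set"
  where "c_zero = {x. x \<longlonglongrightarrow> 0}"

text \<open>With indices starting at \<open>0\<close>, the condition \<open>card F < n\<close> becomes \<open>card F \<le> n\<close>.\<close>

definition rearrangement :: "(nat \<Rightarrow> real) \<Rightarrow> nat \<Rightarrow> real"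
  where "rearrangement x n = (INF F\<in>{F. finite F \<and> card F \<le> n}. SUP k\<in>-F. \<bar>x k\<bar>)"

text \<open>
  A normed sequence space is a carrier \<open>E\<close> together with a function \<open>N\<close>, of which only the values
  on \<open>E\<close> matter.
\<close>

definition normed_seq_space :: "(nat \<Rightarrow> real) set \<Rightarrow> ((nat \<Rightarrow> real) \<Rightarrow> real) \<Rightarrow> bool"
  where "normed_seq_space E N \<longleftrightarrow>
    (\<lambda>n. 0) \<in> E \<and>
    (\<forall>x\<in>E. \<forall>y\<in>E. (\<lambda>n. x n + y n) \<in> E \<and> N (\<lambda>n. x n + y n) \<le> N x + N y) \<and>
    (\<forall>c. \<forall>x\<in>E. (\<lambda>n. c * x n) \<in> E \<and> N (\<lambda>n. c * x n) = \<bar>c\<bar> * N x) \<and>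
    (\<forall>x\<in>E. 0 \<le> N x \<and> (N x = 0 \<longleftrightarrow> x = (\<lambda>n. 0)))"

definition complete_seq_space :: "(nat \<Rightarrow> real) set \<Rightarrow> ((nat \<Rightarrow> real) \<Rightarrow> real) \<Rightarrow> bool"
  where "complete_seq_space E N \<longleftrightarrow>
    (\<forall>X. (\<forall>k. X k \<in> E) \<and>
         (\<forall>e>0. \<exists>M. \<forall>i\<ge>M. \<forall>j\<ge>M. N (\<lambda>n. X i n - X j n) < e) \<longrightarrow>
       (\<exists>x\<in>E. (\<lambda>k. N (\<lambda>n. X k n - x n)) \<longlonglongrightarrow> 0))"

definition banach_symmetric_seq_space :: "(nat \<Rightarrow> real) set \<Rightarrow> ((nat \<Rightarrow> real) \<Rightarrow> real) \<Rightarrow> bool"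
  where "banach_symmetric_seq_space E N \<longleftrightarrow>
    E \<subseteq> l_infty \<and> E \<noteq> {\<lambda>n. 0} \<and> normed_seq_space E N \<and> complete_seq_space E N \<and>
    (\<forall>y\<in>E. \<forall>x\<in>l_infty.
       (\<forall>n. rearrangement x n \<le> rearrangement y n) \<longrightarrow> x \<in> E \<and> N x \<le> N y) \<and>
    N (\<lambda>n. if n = 0 then 1 else 0) = 1"

definition fatou_property :: "(nat \<Rightarrow> real) set \<Rightarrow> ((nat \<Rightarrow> real) \<Rightarrow> real) \<Rightarrow> bool"
  where "fatou_property E N \<longleftrightarrow>
    (\<forall>a. (\<forall>k. a k \<in> E) \<and> (\<forall>k n. 0 \<le> a k n \<and> a k n \<le> a (Suc k) n) \<and>
         bdd_above (range (\<lambda>k. N (a k))) \<longrightarrow>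
       (\<exists>b\<in>E. (\<forall>n. (\<lambda>k. a k n) \<longlonglongrightarrow> b n) \<and> N b = (SUP k. N (a k))))"

definition is_l2 :: "(nat \<Rightarrow> real) set \<Rightarrow> ((nat \<Rightarrow> real) \<Rightarrow> real) \<Rightarrow> bool"
  where "is_l2 E N \<longleftrightarrow>
    E = {x. summable (\<lambda>n. (x n)\<^sup>2)} \<and> (\<forall>x\<in>E. N x = sqrt (\<Sum>n. (x n)\<^sup>2))"


section \<open>Symmetric ideals of compact operators and isometries\<close>

definition symmetric_ideal :: "(nat \<Rightarrow> real) set \<Rightarrow> ('a::complex_hilbert \<Rightarrow> 'a) set"
  where "symmetric_ideal E = {x. compact_clinear x \<and> singular_values x \<in> E}"

definition symmetric_ideal_norm ::
    "((nat \<Rightarrow> real) \<Rightarrow> real) \<Rightarrow> ('a::complex_hilbert \<Rightarrow> 'a) \<Rightarrow> real"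
  where "symmetric_ideal_norm N x = N (singular_values x)"

definition linear_isometry_on ::
    "('a::complex_hilbert \<Rightarrow> 'a) set \<Rightarrow> (('a \<Rightarrow> 'a) \<Rightarrow> real) \<Rightarrow>
     (('a \<Rightarrow> 'a) \<Rightarrow> ('a \<Rightarrow> 'a)) \<Rightarrow> bool"
  where "linear_isometry_on X \<nu> V \<longleftrightarrow>
    V ` X \<subseteq> X \<and>
    (\<forall>x\<in>X. \<forall>y\<in>X. V (\<lambda>u. x u + y u) = (\<lambda>u. V x u + V y u)) \<and>
    (\<forall>c. \<forall>x\<in>X. V (\<lambda>u. c *\<^sub>C x u) = (\<lambda>u. c *\<^sub>C V x u)) \<and>
    (\<forall>x\<in>X. \<nu> (V x) = \<nu> x)"

definition surjective_2_local_isometry_on ::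
    "('a::complex_hilbert \<Rightarrow> 'a) set \<Rightarrow> (('a \<Rightarrow> 'a) \<Rightarrow> real) \<Rightarrow>
     (('a \<Rightarrow> 'a) \<Rightarrow> ('a \<Rightarrow> 'a)) \<Rightarrow> bool"
  where "surjective_2_local_isometry_on X \<nu> T \<longleftrightarrow>
    T ` X = X \<and>
    (\<forall>x\<in>X. \<forall>y\<in>X. \<exists>V. linear_isometry_on X \<nu> V \<and> V ` X = X \<and> T x = V x \<and> T y = V y)"

end

theory Submission
  imports Defs
begin

text \<open>
  For unit vectors \<open>\<xi>\<close> and \<open>\<eta>\<close> let \<open>y\<close> be the operator \<open>u \<mapsto> \<langle>u, \<eta>\<rangle> \<xi>\<close>. The whole argument rests on
  one observation: the matrix coefficient \<open>\<langle>x \<eta>, \<xi>\<rangle>\<close> of an operator \<open>x\<close> in the ideal can be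
  recovered from the norms of the operators \<open>x + n y\<close> and \<open>- x + n y\<close>. The numbers
  \<open>\<parallel>x + n y\<parallel> - n\<close> decrease to a limit \<open>\<delta> x\<close>, the one-sided derivative of the norm at \<open>y\<close> in the
  direction \<open>x\<close>, which is sublinear in \<open>x\<close>. Write \<open>x\<close> as a block matrix with respect to \<open>\<xi>\<close>,
  \<open>\<eta>\<close> and their orthogonal complements. The corner \<open>c = \<langle>x \<eta>, \<xi>\<rangle>\<close> contributes \<open>Re c\<close> to
  \<open>\<delta> x\<close>. The two off-diagonal blocks contribute nothing, since adding them to \<open>n y\<close> moves \<open>\<xi>\<close>
  or \<open>\<eta>\<close> tangentially to the sphere. The opposite block \<open>d\<close> satisfies \<open>\<delta> d = \<delta> (- d)\<close>, because a
  reflection fixes \<open>y\<close> and negates \<open>d\<close>. Hence \<open>\<delta> x - \<delta> (- x) = 2 * Re c\<close>; this is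
  \<open>slope_odd_part\<close>.

  Consequently, if a linear isometry \<open>W\<close> maps \<open>z\<close> to \<open>y\<close>, then \<open>\<langle>W x \<eta>, \<xi>\<rangle>\<close> depends on \<open>x\<close> and
  \<open>z\<close> only and not on \<open>W\<close> (\<open>pairing_determined_by_preimage\<close>). For a surjective 2-local isometry
  \<open>V\<close> take \<open>z\<close> with \<open>V z = y\<close>, and let \<open>W\<close> be the isometry that belongs to the pair \<open>z, z\<close>. The
  isometry that belongs to a pair \<open>x, z\<close> also maps \<open>z\<close> to \<open>y\<close>, so
  \<open>\<langle>V x \<eta>, \<xi>\<rangle> = \<langle>W x \<eta>, \<xi>\<rangle>\<close> for all \<open>x\<close>. The right hand side is linear in \<open>x\<close>, and \<open>\<xi>\<close> and
  \<open>\<eta>\<close> are arbitrary, so \<open>V\<close> is linear.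

  The preparations establish that the ideal is a vector space whose norm satisfies the triangle
  inequality, is invariant under reflections, and is at most the product of the norms of \<open>a\<close> and
  \<open>b\<close> on the operator \<open>u \<mapsto> \<langle>u, b\<rangle> a\<close>. Everything follows from a dual description: a compact \<open>x\<close> belongs
  to the ideal with norm at most \<open>M\<close> iff \<open>\<bar>\<Sum>i<n. b i * \<langle>x (f i), e i\<rangle>\<bar> \<le> M\<close> for all finite
  orthonormal families \<open>e\<close>, \<open>f\<close> and all functionals \<open>b\<close> of norm at most \<open>1\<close> on the sequence space
  (\<open>ideal_pairing_bound\<close> and \<open>ideal_if_pairing_bound\<close>). One direction is Ky Fan's inequality and
  summation by parts. The other combines the Schmidt decomposition of \<open>x\<close>, the Hahn--Banach
  theorem in finite dimension, and the Fatou property.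
\<close>

section \<open>Inner products and orthonormal families\<close>

lemma cinner_add_right: "cinner x (y + z) = cinner x y + cinner x z"
  by (metis cinner_add_left cinner_commute complex_cnj_add)

lemma cinner_scaleC_right: "cinner x (a *\<^sub>C y) = cnj a * cinner x y"
  by (metis cinner_scaleC_left cinner_commute complex_cnj_mult)

lemma scaleC_minus1: "- x = (-1) *\<^sub>C (x :: 'a::complex_hilbert)"
  using scaleC_of_real[of "-1" x] by simp

lemma cinner_minus_left: "cinner (- x) y = - cinner x y"
  unfolding scaleC_minus1[of x] cinner_scaleC_left by simp

lemma cinner_minus_right: "cinner x (- y) = - cinner x y"
  unfolding scaleC_minus1[of y] cinner_scaleC_right by simp

lemma cinner_diff_left: "cinner (x - y) z = cinner x z - cinner y z"
  using cinner_add_left[of x "- y" z] by (simp add: cinner_minus_left)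

lemma cinner_diff_right: "cinner x (y - z) = cinner x y - cinner x z"
  using cinner_add_right[of x y "- z"] by (simp add: cinner_minus_right)

lemma cinner_zero_left [simp]: "cinner 0 x = 0"
  using cinner_add_left[of 0 0 x] by simp

lemma cinner_zero_right [simp]: "cinner x 0 = 0"
  using cinner_add_right[of x 0 0] by simp

lemma cinner_sum_left: "cinner (\<Sum>i\<in>A. f i) y = (\<Sum>i\<in>A. cinner (f i) y)"
  by (induction A rule: infinite_finite_induct) (simp_all add: cinner_add_left)

lemma cinner_sum_right: "cinner x (\<Sum>i\<in>A. f i) = (\<Sum>i\<in>A. cinner x (f i))"
  by (induction A rule: infinite_finite_induct) (simp_all add: cinner_add_right)

lemmas cinner_simps = cinner_add_left cinner_add_right cinner_diff_left cinner_diff_right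
  cinner_minus_left cinner_minus_right cinner_scaleC_left cinner_scaleC_right

lemma cinner_self: "cinner x x = complex_of_real ((norm x)\<^sup>2)"
proof -
  have "Im (cinner x x) = 0"
    using arg_cong[OF cinner_commute[of x x], of Im] by simp
  moreover have "0 \<le> Re (cinner x x)"
    using norm_ge_zero[of x] unfolding norm_eq_sqrt_cinner by simp
  ultimately show ?thesis
    by (simp add: complex_eq_iff norm_eq_sqrt_cinner)
qed

lemma cinner_self_eq_1: "norm x = 1 \<Longrightarrow> cinner x x = 1"
  by (simp add: cinner_self)

lemma cinner_eq_0_commute: "cinner x y = 0 \<longleftrightarrow> cinner y x = 0"
  by (metis cinner_commute complex_cnj_zero)

lemma norm_cinner_commute: "norm (cinner x y) = norm (cinner y x)"
  by (metis cinner_commute complex_mod_cnj)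

lemma power2_norm_add:
  "(norm (x + y))\<^sup>2 = (norm x)\<^sup>2 + (norm y)\<^sup>2 + 2 * Re (cinner x y)" for x y :: "'a::complex_hilbert"
proof -
  have "complex_of_real ((norm (x + y))\<^sup>2) = cinner x x + cinner y y + (cinner x y + cnj (cinner x y))"
    unfolding cinner_self[symmetric] using cinner_commute[of y x] by (simp add: cinner_simps)
  then have "Re (complex_of_real ((norm (x + y))\<^sup>2)) = Re (cinner x x + cinner y y + (cinner x y + cnj (cinner x y)))"
    by simp
  then show ?thesis
    by (simp add: cinner_self)
qed

lemma norm_scaleC: "norm (a *\<^sub>C x) = norm a * norm (x :: 'a::complex_hilbert)"
proof -
  have "complex_of_real ((norm (a *\<^sub>C x))\<^sup>2) = complex_of_real ((norm a * norm x)\<^sup>2)"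
    unfolding cinner_self[symmetric] cinner_scaleC_left cinner_scaleC_right
    by (simp add: cinner_self power_mult_distrib complex_norm_square[symmetric] mult.assoc[symmetric] mult.commute[of "cnj a"] del: of_real_power)
  then have "(norm (a *\<^sub>C x))\<^sup>2 = (norm a * norm x)\<^sup>2"
    using of_real_eq_iff by blast
  then show ?thesis
    by (simp add: power2_eq_iff_nonneg)
qed

lemma pythagoras:
  "cinner x y = 0 \<Longrightarrow> (norm (x + y))\<^sup>2 = (norm x)\<^sup>2 + (norm y)\<^sup>2"
  by (simp add: power2_norm_add)

lemma norm_cinner_le: "norm (cinner x y) \<le> norm x * norm y"
proof (cases "y = 0")
  case False
  define c where "c = cinner x y / complex_of_real ((norm y)\<^sup>2)"
  have ny: "(norm y)\<^sup>2 \<noteq> 0" using False by simp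
  have "cinner (x - c *\<^sub>C y) (c *\<^sub>C y) = 0"
    using ny by (simp add: cinner_simps cinner_self c_def)
  from pythagoras[OF this] have "(norm x)\<^sup>2 \<ge> (norm (c *\<^sub>C y))\<^sup>2"
    by simp
  then have "norm x \<ge> norm c * norm y"
    by (metis norm_scaleC norm_ge_zero power2_le_imp_le)
  moreover have "norm c = norm (cinner x y) / (norm y)\<^sup>2"
    by (simp add: c_def norm_divide norm_power)
  ultimately show ?thesis
    using False by (simp add: field_simps power2_eq_square)
qed simp

lemma cinner_eqI: "(\<And>v. cinner x v = cinner y v) \<Longrightarrow> x = y"
proof -
  assume "\<And>v. cinner x v = cinner y v"
  then have "cinner (x - y) (x - y) = 0" by (simp add: cinner_simps)
  then show "x = y" by (simp add: cinner_self)
qed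

lemma bounded_linear_cinner_left: "bounded_linear (\<lambda>x. cinner x y)"
proof (rule bounded_linear_intro)
  show "cinner (r *\<^sub>R x) y = r *\<^sub>R cinner x y" for r x
    unfolding scaleC_of_real[symmetric] cinner_scaleC_left by (simp add: scaleC_complex_def)
  show "norm (cinner x y) \<le> norm x * norm y" for x by (rule norm_cinner_le)
qed (rule cinner_add_left)

lemma bounded_linear_cinner_right: "bounded_linear (\<lambda>y. cinner x y)"
proof (rule bounded_linear_intro)
  show "cinner x (r *\<^sub>R y) = r *\<^sub>R cinner x y" for r y
    unfolding scaleC_of_real[symmetric] cinner_scaleC_right by (simp add: scaleC_complex_def)
  show "norm (cinner x y) \<le> norm y * norm x" for y using norm_cinner_le[of x y] by (simp add: mult.commute)
qed (rule cinner_add_right)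

lemmas tendsto_cinner_left = bounded_linear.tendsto[OF bounded_linear_cinner_left]
lemmas tendsto_cinner_right = bounded_linear.tendsto[OF bounded_linear_cinner_right]

lemma bounded_linear_scaleC: "bounded_linear (\<lambda>x::'a::complex_hilbert. a *\<^sub>C x)"
proof (rule bounded_linear_intro)
  show "a *\<^sub>C (r *\<^sub>R x) = r *\<^sub>R (a *\<^sub>C x)" for r and x :: 'a
    unfolding scaleC_of_real[symmetric] scaleC_scaleC by (simp add: mult.commute)
  show "norm (a *\<^sub>C x) \<le> norm x * norm a" for x :: 'a by (simp add: norm_scaleC)
qed (rule scaleC_add_right)

lemmas tendsto_scaleC = bounded_linear.tendsto[OF bounded_linear_scaleC]

lemma scaleC_one [simp]: "1 *\<^sub>C x = (x :: 'a::complex_hilbert)"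
  by (rule complex_vector.scale_one)

lemma normalize_vector:
  assumes "v \<noteq> (0 :: 'a::complex_hilbert)"
  shows "norm (complex_of_real (1 / norm v) *\<^sub>C v) = 1"
  using assms by (simp add: norm_scaleC norm_divide)

lemma clinearI:
  fixes x :: "'a::complex_hilbert \<Rightarrow> 'a"
  assumes "\<And>u v. x (u + v) = x u + x v" and "\<And>c u. x (c *\<^sub>C u) = c *\<^sub>C x u"
  shows "clinear x"
  by (simp add: assms Vector_Spaces.linear_iff complex_vector.vector_space_axioms)

lemma clinear_add: "clinear x \<Longrightarrow> x (u + v) = x u + x v"
  and clinear_scaleC: "clinear x \<Longrightarrow> x (c *\<^sub>C u) = c *\<^sub>C x u"
  by (simp_all add: Vector_Spaces.linear_iff)

lemma clinear_zero: "clinear x \<Longrightarrow> x 0 = 0"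
  using clinear_scaleC[of x 0 0] by simp

lemma clinear_diff: "clinear x \<Longrightarrow> x (u - v) = x u - x v"
  by (metis add_diff_cancel_right' clinear_add diff_add_cancel)

lemma clinear_sum: "clinear x \<Longrightarrow> x (\<Sum>i\<in>A. g i) = (\<Sum>i\<in>A. x (g i))"
  by (induction A rule: infinite_finite_induct) (simp_all add: clinear_add clinear_zero)

lemma clinear_bounded_linear:
  assumes "clinear x" and "\<And>u. norm (x u) \<le> K * norm u"
  shows "bounded_linear x"
proof (rule bounded_linear_intro)
  show "x (r *\<^sub>R u) = r *\<^sub>R x u" for r u
    unfolding scaleC_of_real[symmetric] by (rule clinear_scaleC[OF assms(1)])
  show "norm (x u) \<le> norm u * K" for u using assms(2)[of u] by (simp add: mult.commute)
qed (rule clinear_add[OF assms(1)])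


definition orthonormal_on :: "nat set \<Rightarrow> (nat \<Rightarrow> 'a::complex_hilbert) \<Rightarrow> bool"
  where "orthonormal_on A e \<longleftrightarrow> (\<forall>i\<in>A. \<forall>j\<in>A. cinner (e i) (e j) = (if i = j then 1 else 0))"

lemma orthonormal_on_subset: "orthonormal_on A e \<Longrightarrow> B \<subseteq> A \<Longrightarrow> orthonormal_on B e"
  unfolding orthonormal_on_def by blast

lemma orthonormal_onD: "orthonormal_on A e \<Longrightarrow> i \<in> A \<Longrightarrow> j \<in> A \<Longrightarrow> cinner (e i) (e j) = (if i = j then 1 else 0)"
  by (auto simp: orthonormal_on_def)

lemma orthonormal_on_norm: "orthonormal_on A e \<Longrightarrow> i \<in> A \<Longrightarrow> norm (e i) = 1"
  using orthonormal_onD[of A e i i] by (simp add: norm_eq_sqrt_cinner)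

lemma cinner_orthonormal_sum:
  assumes "orthonormal_on A e" "finite A" "j \<in> A"
  shows "cinner (\<Sum>i\<in>A. c i *\<^sub>C e i) (e j) = c j"
proof -
  have "cinner (\<Sum>i\<in>A. c i *\<^sub>C e i) (e j) = (\<Sum>i\<in>A. if i = j then c i else 0)"
    unfolding cinner_sum_left
    by (rule sum.cong) (use assms in \<open>auto simp: cinner_scaleC_left orthonormal_onD\<close>)
  then show ?thesis using assms by simp
qed

lemma norm_orthonormal_sum:
  assumes "orthonormal_on A e" "finite A"
  shows "(norm (\<Sum>i\<in>A. c i *\<^sub>C e i))\<^sup>2 = (\<Sum>i\<in>A. (norm (c i))\<^sup>2)"
proof -
  have "complex_of_real ((norm (\<Sum>i\<in>A. c i *\<^sub>C e i))\<^sup>2) = (\<Sum>j\<in>A. cnj (c j) * cinner (\<Sum>i\<in>A. c i *\<^sub>C e i) (e j))"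
    unfolding cinner_self[symmetric] by (subst cinner_sum_right) (simp add: cinner_scaleC_right)
  also have "\<dots> = (\<Sum>j\<in>A. cnj (c j) * c j)"
    using cinner_orthonormal_sum[OF assms] by simp
  also have "\<dots> = complex_of_real (\<Sum>i\<in>A. (norm (c i))\<^sup>2)"
    unfolding of_real_sum by (rule sum.cong) (simp_all add: complex_norm_square mult.commute del: of_real_power)
  finally show ?thesis using of_real_eq_iff by blast
qed

text \<open>
  The projection onto the span of the family and the remainder are orthogonal, so Pythagoras
  splits the norm of \<open>u\<close>; both Bessel's inequality and the bound for the remainder
  come from here.
\<close>

lemma norm_orthonormal_remainder:
  assumes "orthonormal_on A e" "finite A"
  shows "(norm u)\<^sup>2 = (norm (u - (\<Sum>i\<in>A. cinner u (e i) *\<^sub>C e i)))\<^sup>2 + (\<Sum>i\<in>A. (norm (cinner u (e i)))\<^sup>2)"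
proof -
  let ?S = "\<Sum>i\<in>A. cinner u (e i) *\<^sub>C e i"
  have "cinner (u - ?S) ?S = 0"
    unfolding cinner_sum_right
    by (rule sum.neutral) (use cinner_orthonormal_sum[OF assms] in \<open>auto simp: cinner_simps\<close>)
  from pythagoras[OF this] show ?thesis
    by (simp add: norm_orthonormal_sum[OF assms])
qed

lemma bessel:
  assumes "orthonormal_on A e" "finite A"
  shows "(\<Sum>i\<in>A. (norm (cinner u (e i)))\<^sup>2) \<le> (norm u)\<^sup>2"
  using norm_orthonormal_remainder[OF assms, of u] by simp

lemma norm_remainder_le:
  assumes "orthonormal_on A e" "finite A"
  shows "norm (u - (\<Sum>i\<in>A. cinner u (e i) *\<^sub>C e i)) \<le> norm u"
  by (rule power2_le_imp_le) (use norm_orthonormal_remainder[OF assms, of u] in \<open>simp_all add: sum_nonneg\<close>)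

lemma cinner_remainder:
  assumes "orthonormal_on A e" "finite A" "j \<in> A"
  shows "cinner (u - (\<Sum>i\<in>A. cinner u (e i) *\<^sub>C e i)) (e j) = 0"
  by (simp add: cinner_diff_left cinner_orthonormal_sum[OF assms])

text \<open>
  With unit vectors \<open>u\<close> and \<open>v\<close> the bound is \<open>1\<close>: the products of the coefficients form a
  doubly substochastic matrix, which is what the trace inequality below needs.
\<close>

lemma bessel_product:
  assumes "orthonormal_on A e" "orthonormal_on A f" "finite A"
  shows "(\<Sum>i\<in>A. norm (cinner u (e i)) * norm (cinner v (f i))) \<le> ((norm u)\<^sup>2 + (norm v)\<^sup>2) / 2"
proof -
  have "(\<Sum>i\<in>A. norm (cinner u (e i)) * norm (cinner v (f i)))
      \<le> (\<Sum>i\<in>A. ((norm (cinner u (e i)))\<^sup>2 + (norm (cinner v (f i)))\<^sup>2) / 2)"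
  proof (rule sum_mono)
    fix i
    show "norm (cinner u (e i)) * norm (cinner v (f i))
        \<le> ((norm (cinner u (e i)))\<^sup>2 + (norm (cinner v (f i)))\<^sup>2) / 2"
      using sum_squares_bound[of "norm (cinner u (e i))" "norm (cinner v (f i))"] by simp
  qed
  also have "\<dots> \<le> ((norm u)\<^sup>2 + (norm v)\<^sup>2) / 2"
    using bessel[OF assms(1,3), of u] bessel[OF assms(2,3), of v]
    by (simp add: sum.distrib flip: sum_divide_distrib)
  finally show ?thesis .
qed

text \<open>
  Dependent choice in the form used for orthonormal sequences: the requirement \<open>R m\<close> on the
  \<open>m\<close>-th term may mention the earlier terms.
\<close>

lemma sequence_by_prefix_choice:
  fixes R :: "nat \<Rightarrow> (nat \<Rightarrow> 'b) \<Rightarrow> bool"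
  assumes step: "\<And>n x. (\<And>m. m < n \<Longrightarrow> R m x) \<Longrightarrow> \<exists>g. R n (x(n := g))"
    and local: "\<And>m x y. (\<And>i. i \<le> m \<Longrightarrow> x i = y i) \<Longrightarrow> R m x \<Longrightarrow> R m y"
  shows "\<exists>x. \<forall>m. R m x"
proof -
  have "\<exists>F. \<forall>n. (\<forall>m<n. R m (F n)) \<and> (\<exists>g. F (Suc n) = (F n)(n := g))"
  proof (rule dependent_nat_choice)
    fix x :: "nat \<Rightarrow> 'b" and n assume pre: "\<forall>m<n. R m x"
    then obtain g where g: "R n (x(n := g))" using step by blast
    have "R m (x(n := g))" if "m < Suc n" for m
    proof (cases "m = n")
      case False
      with that have "m < n" by simp
      show ?thesis by (rule local[of m x]) (use pre \<open>m < n\<close> in auto)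
    qed (use g in simp)
    then show "\<exists>y. (\<forall>m<Suc n. R m y) \<and> (\<exists>g. y = x(n := g))" by blast
  qed simp
  then obtain F where F: "\<And>n m. m < n \<Longrightarrow> R m (F n)" and upd: "\<And>n. \<exists>g. F (Suc n) = (F n)(n := g)"
    by blast
  \<comment> \<open>the prefixes \<open>F n\<close> cohere, so their diagonal is the required sequence\<close>
  have stable: "F (m + k) i = F m i" if "i < m" for m k i
  proof (induction k)
    case (Suc k)
    obtain g where "F (Suc (m + k)) = (F (m + k))(m + k := g)" using upd by blast
    then show ?case using Suc that by simp
  qed simp
  define x where "x i = F (Suc i) i" for i
  have "R m x" for m
  proof (rule local[of m "F (Suc m)"])
    fix i assume "i \<le> m"
    then show "F (Suc m) i = x i" using stable[of i "Suc i" "m - i"] by (simp add: x_def)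
  qed (use F in simp)
  then show ?thesis by blast
qed

locale infinite_dimensional_hilbert =
  fixes hilbert :: "'h::complex_hilbert itself"
  assumes infinite_dimensional: "\<not> (\<exists>B :: 'h set. finite B \<and> complex_vector.span B = UNIV)"
begin

text \<open>
  A vector outside the span of the finite family leaves a non-zero remainder after projection.
\<close>

lemma unit_orthogonal_exists:
  fixes e :: "nat \<Rightarrow> 'h"
  assumes "orthonormal_on A e" "finite A"
  shows "\<exists>g. norm g = 1 \<and> (\<forall>i\<in>A. cinner g (e i) = 0)"
proof -
  have "complex_vector.span (e ` A) \<noteq> UNIV"
    using infinite_dimensional assms(2) by blast
  then obtain v where v: "v \<notin> complex_vector.span (e ` A)" by blast
  define w where "w = v - (\<Sum>i\<in>A. cinner v (e i) *\<^sub>C e i)"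
  have "(\<Sum>i\<in>A. cinner v (e i) *\<^sub>C e i) \<in> complex_vector.span (e ` A)"
    by (intro complex_vector.span_sum complex_vector.span_scale complex_vector.span_base) simp
  then have "w \<noteq> 0" using v by (auto simp: w_def)
  have "cinner w (e i) = 0" if "i \<in> A" for i
    unfolding w_def by (rule cinner_remainder[OF assms that])
  then show ?thesis
    using normalize_vector[OF \<open>w \<noteq> 0\<close>]
    by (intro exI[of _ "complex_of_real (1 / norm w) *\<^sub>C w"]) (auto simp: cinner_scaleC_left)
qed

lemma orthonormal_lessThanI:
  fixes e :: "nat \<Rightarrow> 'h"
  assumes "\<And>m. m < n \<Longrightarrow> norm (e m) = 1" "\<And>m i. m < n \<Longrightarrow> i < m \<Longrightarrow> cinner (e m) (e i) = 0"
  shows "orthonormal_on {..<n} e"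
  unfolding orthonormal_on_def
proof (intro ballI)
  fix i j assume ij: "i \<in> {..<n}" "j \<in> {..<n}"
  then consider "i = j" | "i < j" | "j < i" by linarith
  then show "cinner (e i) (e j) = (if i = j then 1 else 0)"
  proof cases
    case 2 then show ?thesis using assms(2)[of j i] ij cinner_eq_0_commute[of "e i"] by auto
  qed (use ij assms in \<open>auto simp: cinner_self\<close>)
qed

lemma orthonormal_UNIVI:
  fixes e :: "nat \<Rightarrow> 'h"
  assumes "\<And>m. norm (e m) = 1" "\<And>m i. i < m \<Longrightarrow> cinner (e m) (e i) = 0"
  shows "orthonormal_on UNIV e"
proof -
  have "orthonormal_on {..<n} e" for n using assms by (intro orthonormal_lessThanI)
  then have "cinner (e i) (e j) = (if i = j then 1 else 0)" for i j
    using orthonormal_onD[of "{..<Suc (max i j)}" e i j] by (simp add: less_Suc_eq_le)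
  then show ?thesis by (simp add: orthonormal_on_def)
qed

text \<open>
  An operator of finite rank determines only finitely many singular vectors; this supplies the
  remaining ones, so that every operator can be treated with infinite systems.
\<close>

lemma orthonormal_extend:
  fixes e :: "nat \<Rightarrow> 'h"
  assumes e: "orthonormal_on {..<n} e"
  shows "\<exists>e'. orthonormal_on UNIV e' \<and> (\<forall>i<n. e' i = e i)"
proof -
  define R where "R m x \<longleftrightarrow> (m < n \<longrightarrow> x m = e m) \<and> norm (x m) = 1 \<and> (\<forall>i<m. cinner (x m) (x i) = 0)"
    for m and x :: "nat \<Rightarrow> 'h"
  have "\<exists>x. \<forall>m. R m x"
  proof (rule sequence_by_prefix_choice)
    fix m and x :: "nat \<Rightarrow> 'h" assume pre: "\<And>k. k < m \<Longrightarrow> R k x"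
    show "\<exists>g. R m (x(m := g))"
    proof (cases "m < n")
      case True
      have "x i = e i" if "i < m" for i using pre[OF that] that True by (simp add: R_def)
      then have "R m (x(m := e m))"
        using True e orthonormal_on_norm[OF e] by (auto simp: R_def orthonormal_onD)
      then show ?thesis ..
    next
      case False
      have "orthonormal_on {..<m} x" using pre by (intro orthonormal_lessThanI) (auto simp: R_def)
      then obtain g where "norm g = 1" "\<forall>i\<in>{..<m}. cinner g (x i) = 0"
        using unit_orthogonal_exists by blast
      then have "R m (x(m := g))" using False by (auto simp: R_def)
      then show ?thesis ..
    qed
  qed (auto simp: R_def)
  then obtain x where "\<And>m. R m x" by blast
  then show ?thesis
    by (intro exI[of _ x]) (auto simp: R_def intro: orthonormal_UNIVI)
qed

end


section \<open>The Schmidt decomposition of a compact operator\<close>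

lemma compact_clinearI:
  assumes "clinear x" "compact K" "x ` cball 0 1 \<subseteq> K"
  shows "compact_clinear x"
proof -
  have "closure (x ` cball 0 1) \<subseteq> K"
    using assms by (simp add: closure_minimal compact_imp_closed)
  then have "compact (closure (x ` cball 0 1))"
    using compact_Int_closed[OF assms(2) closed_closure, of "x ` cball 0 1"] by (simp add: Int_absorb1)
  then show ?thesis using assms(1) by (simp add: compact_clinear_def)
qed

text \<open>
  The image of the unit ball has compact closure, hence is bounded, and homogeneity does the rest.
\<close>

lemma compact_clinear_bounded:
  assumes "compact_clinear x"
  shows "\<exists>K. \<forall>u. norm (x u) \<le> K * norm u"
proof -
  have x: "clinear x" using assms by (simp add: compact_clinear_def)
  have "bounded (closure (x ` cball 0 1))"
    using assms compact_imp_bounded by (auto simp: compact_clinear_def)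
  then have "bounded (x ` cball 0 1)" by (rule bounded_subset) (rule closure_subset)
  then obtain K where "\<forall>w\<in>x ` cball 0 1. norm w \<le> K"
    unfolding bounded_iff ..
  then have K: "norm (x u) \<le> K" if "norm u \<le> 1" for u using that by auto
  have "norm (x u) \<le> K * norm u" for u
  proof (cases "u = 0")
    case False
    have "norm (x (complex_of_real (1 / norm u) *\<^sub>C u)) \<le> K"
      by (rule K) (simp only: normalize_vector[OF False])
    then show ?thesis
      using False by (simp add: clinear_scaleC[OF x] norm_scaleC norm_divide field_simps)
  qed (simp add: clinear_zero[OF x])
  then show ?thesis by blast
qed

lemma compact_clinear_bounded_linear: "compact_clinear x \<Longrightarrow> bounded_linear x"
  using compact_clinear_bounded[of x] clinear_bounded_linear[of x] by (auto simp: compact_clinear_def)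

lemma parallelogram:
  "(norm (x - y))\<^sup>2 = 2 * (norm x)\<^sup>2 + 2 * (norm y)\<^sup>2 - (norm (x + y))\<^sup>2" for x y :: "'a::complex_hilbert"
  using power2_norm_add[of x y] power2_norm_add[of x "- y"] by (simp add: cinner_minus_right)

context infinite_dimensional_hilbert
begin

text \<open>
  A maximising sequence for \<open>norm (x u)\<close> has a subsequence along which \<open>x u\<close> converges; the
  parallelogram identity turns this into convergence of \<open>u\<close> itself, because sums of nearly
  maximising unit vectors have norm close to \<open>2\<close>.
\<close>

lemma compact_clinear_maximizer:
  fixes x :: "'h \<Rightarrow> 'h"
  assumes x: "compact_clinear x" and f: "orthonormal_on {..<n} f"
  shows "\<exists>g. norm g = 1 \<and> (\<forall>i<n. cinner g (f i) = 0) \<and>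
    (\<forall>u. (\<forall>i<n. cinner u (f i) = 0) \<longrightarrow> norm (x u) \<le> norm (x g) * norm u)"
proof -
  have lin: "clinear x" using x by (simp add: compact_clinear_def)
  define M where "M = {u. norm u = 1 \<and> (\<forall>i<n. cinner u (f i) = 0)}"
  define S where "S = (SUP u\<in>M. norm (x u))"
  obtain K where K: "\<And>u. norm (x u) \<le> K * norm u" using compact_clinear_bounded[OF x] by blast
  obtain g0 where g0: "g0 \<in> M"
    using unit_orthogonal_exists[OF f] by (auto simp: M_def)
  have bdd: "bdd_above ((\<lambda>u. norm (x u)) ` M)"
  proof (rule bdd_aboveI2)
    show "norm (x u) \<le> K" if "u \<in> M" for u using K[of u] that by (simp add: M_def)
  qed
  have S_unit: "norm (x u) \<le> S" if "u \<in> M" for u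
    unfolding S_def by (rule cSUP_upper[OF that bdd])
  have S: "norm (x u) \<le> S * norm u" if "\<forall>i<n. cinner u (f i) = 0" for u
  proof (cases "u = 0")
    case False
    have "complex_of_real (1 / norm u) *\<^sub>C u \<in> M"
      using that normalize_vector[OF False] by (auto simp: M_def cinner_scaleC_left)
    from S_unit[OF this] show ?thesis
      using False by (simp add: clinear_scaleC[OF lin] norm_scaleC norm_divide field_simps)
  qed (simp add: clinear_zero[OF lin])
  have S0: "0 \<le> S" using S_unit[OF g0] norm_ge_zero order_trans by blast
  have "\<exists>g\<in>M. S \<le> norm (x g)"
  proof (cases "S = 0")
    case True
    then show ?thesis using g0 by auto
  next
    case False
    with S0 have Spos: "0 < S" by simp
    have "\<exists>u\<in>M. S - inverse (real (Suc k)) < norm (x u)" for k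
      using less_cSUP_iff[OF _ bdd, of "S - inverse (real (Suc k))"] g0
      by (auto simp: S_def[symmetric])
    then obtain w where w: "\<And>k. w k \<in> M" "\<And>k. S - inverse (real (Suc k)) < norm (x (w k))"
      by metis
    have "x (w k) \<in> closure (x ` cball 0 1)" for k
      using w(1)[of k] by (intro closure_subset[THEN subsetD]) (auto simp: M_def)
    moreover have "seq_compact (closure (x ` cball 0 1))"
      using x by (simp add: compact_clinear_def compact_imp_seq_compact)
    ultimately obtain l r where r: "strict_mono (r :: nat \<Rightarrow> nat)" and l: "((\<lambda>k. x (w k)) \<circ> r) \<longlonglongrightarrow> l"
      using seq_compactE[of _ "\<lambda>k. x (w k)"] by metis
    define v where "v = w \<circ> r"
    have vM: "v k \<in> M" for k using w(1) by (simp add: v_def)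
    have xv: "(\<lambda>k. x (v k)) \<longlonglongrightarrow> l" using l by (simp add: v_def o_def)
    \<comment> \<open>the limit \<open>l\<close> of \<open>x (w k)\<close> along \<open>r\<close> has the maximal norm \<open>S\<close>\<close>
    have "(\<lambda>k. norm (x (w k))) \<longlonglongrightarrow> S"
    proof (rule tendsto_sandwich[of "\<lambda>k. S - inverse (real (Suc k))" _ _ "\<lambda>_. S"])
      show "(\<lambda>k. S - inverse (real (Suc k))) \<longlonglongrightarrow> S"
        using tendsto_diff[OF tendsto_const[of S] LIMSEQ_inverse_real_of_nat] by simp
      show "\<forall>\<^sub>F k in sequentially. S - inverse (real (Suc k)) \<le> norm (x (w k))"
        by (intro always_eventually allI less_imp_le w(2))
      show "\<forall>\<^sub>F k in sequentially. norm (x (w k)) \<le> S"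
        by (intro always_eventually allI S_unit w(1))
    qed simp
    from LIMSEQ_subseq_LIMSEQ[OF this r] have "(\<lambda>k. norm (x (v k))) \<longlonglongrightarrow> S"
      by (simp add: v_def o_def)
    with tendsto_norm[OF xv] have norm_l: "norm l = S" using LIMSEQ_unique by blast
    have "Cauchy v"
    proof (rule CauchyI)
      fix \<epsilon> :: real assume "0 < \<epsilon>"
      \<comment> \<open>if \<open>x (v j)\<close> and \<open>x (v k)\<close> are \<open>\<delta>\<close>-close to \<open>l\<close>, then \<open>norm (v j + v k) > 2 - 2 * \<delta> / S\<close>,
        and the parallelogram identity gives \<open>(norm (v j - v k))\<^sup>2 < 8 * \<delta> / S\<close>\<close>
      define \<delta> where "\<delta> = min S (S * \<epsilon>\<^sup>2 / 8)"
      have \<delta>: "0 < \<delta>" "\<delta> \<le> S" "8 * \<delta> / S \<le> \<epsilon>\<^sup>2"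
        using Spos \<open>0 < \<epsilon>\<close> by (auto simp: \<delta>_def min_def field_simps)
      from LIMSEQ_D[OF xv \<delta>(1)] obtain k0 where k0: "\<And>k. k \<ge> k0 \<Longrightarrow> norm (x (v k) - l) < \<delta>" by blast
      show "\<exists>k0. \<forall>j\<ge>k0. \<forall>k\<ge>k0. norm (v j - v k) < \<epsilon>"
      proof (intro exI[of _ k0] allI impI)
        fix j k assume jk: "k0 \<le> j" "k0 \<le> k"
        have "norm (2 *\<^sub>R l) - norm ((x (v j) - l) + (x (v k) - l)) \<le> norm (x (v j) + x (v k))"
          using norm_triangle_ineq2[of "2 *\<^sub>R l" "- ((x (v j) - l) + (x (v k) - l))"]
            norm_minus_commute[of "l + l" "x (v j) + x (v k)"]
          by (simp add: algebra_simps scaleR_2)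
        moreover have "norm ((x (v j) - l) + (x (v k) - l)) < 2 * \<delta>"
          using norm_triangle_ineq[of "x (v j) - l" "x (v k) - l"] k0[OF jk(1)] k0[OF jk(2)] by linarith
        ultimately have "2 * S - 2 * \<delta> < norm (x (v j + v k))"
          by (simp add: clinear_add[OF lin] norm_l)
        also have "\<dots> \<le> S * norm (v j + v k)"
          using vM[of j] vM[of k] by (intro S) (auto simp: M_def cinner_add_left)
        finally have "2 - 2 * (\<delta> / S) < norm (v j + v k)"
          using Spos by (simp add: field_simps)
        then have "(2 - 2 * (\<delta> / S))\<^sup>2 < (norm (v j + v k))\<^sup>2"
          using \<delta> Spos by (intro power_strict_mono) (auto simp: field_simps)
        moreover have "(2 - 2 * (\<delta> / S))\<^sup>2 \<ge> 4 - 8 * (\<delta> / S)"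
          by (simp add: power2_eq_square algebra_simps)
        ultimately have "(norm (v j - v k))\<^sup>2 < \<epsilon>\<^sup>2"
          using parallelogram[of "v j" "v k"] vM[of j] vM[of k] \<delta>(3) by (simp add: M_def)
        then show "norm (v j - v k) < \<epsilon>"
          using \<open>0 < \<epsilon>\<close> by (simp add: power2_less_imp_less)
      qed
    qed
    then obtain g where g: "v \<longlonglongrightarrow> g" using Cauchy_convergent convergent_def by blast
    have "norm g = 1"
      using tendsto_norm[OF g] vM by (simp add: M_def LIMSEQ_const_iff)
    moreover have "cinner g (f i) = 0" if "i < n" for i
      using tendsto_cinner_left[OF g, of "f i"] vM that by (simp add: M_def LIMSEQ_const_iff)
    moreover have "x g = l"
      using LIMSEQ_unique[OF bounded_linear.tendsto[OF compact_clinear_bounded_linear[OF x] g] xv] .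
    ultimately show ?thesis using norm_l by (auto simp: M_def)
  qed
  then obtain g where g: "g \<in> M" "S \<le> norm (x g)" by blast
  have "norm (x u) \<le> norm (x g) * norm u" if "\<forall>i<n. cinner u (f i) = 0" for u
    using S[OF that] mult_right_mono[OF g(2) norm_ge_zero[of u]] by linarith
  then show ?thesis using g(1) by (auto simp: M_def)
qed

end

text \<open>
  Otherwise moving from \<open>g\<close> a little in the direction of \<open>v\<close> would raise the quotient of the
  norms of \<open>x u\<close> and \<open>u\<close>: the gain is of first order in the step, the loss of second order.
\<close>

lemma maximizer_orthogonal:
  assumes x: "clinear x" and g: "norm g = 1" and vg: "cinner v g = 0"
    and max: "\<And>c. norm (x (g + c *\<^sub>C v)) \<le> norm (x g) * norm (g + c *\<^sub>C v)"
  shows "cinner (x v) (x g) = 0"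
proof (rule ccontr)
  define w where "w = cinner (x v) (x g)"
  assume "cinner (x v) (x g) \<noteq> 0"
  then have w: "w \<noteq> 0" by (simp add: w_def)
  define K where "K = (norm (x g) * norm v)\<^sup>2"
  have K: "0 \<le> K" by (simp add: K_def)
  define t where "t = 1 / (K + 1)"
  have t: "0 < t" using K by (simp add: t_def)
  \<comment> \<open>the phase of \<open>c\<close> makes the first order term real and positive;
    \<open>t\<close> is small enough for it to dominate the second order term\<close>
  define c where "c = complex_of_real t * cnj w"
  have "(norm (g + c *\<^sub>C v))\<^sup>2 = 1 + (norm (c *\<^sub>C v))\<^sup>2"
    using pythagoras[of g "c *\<^sub>C v"] vg g by (simp add: cinner_scaleC_right cinner_eq_0_commute[of g])
  then have "(norm (x g) * norm (g + c *\<^sub>C v))\<^sup>2 = (norm (x g))\<^sup>2 + (norm c)\<^sup>2 * K"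
    by (simp add: power_mult_distrib K_def norm_scaleC algebra_simps)
  moreover have "(norm (x (g + c *\<^sub>C v)))\<^sup>2 \<le> (norm (x g) * norm (g + c *\<^sub>C v))\<^sup>2"
    by (rule power_mono[OF max norm_ge_zero])
  moreover have "(norm (x (g + c *\<^sub>C v)))\<^sup>2 \<ge> (norm (x g))\<^sup>2 + 2 * Re (cinner (x g) (c *\<^sub>C x v))"
    using power2_norm_add[of "x g" "c *\<^sub>C x v"] by (simp add: clinear_add[OF x] clinear_scaleC[OF x])
  moreover have "cinner (x g) (c *\<^sub>C x v) = complex_of_real (t * (norm w)\<^sup>2)"
    using cinner_commute[of "x g" "x v"]
    by (simp add: cinner_scaleC_right c_def w_def complex_norm_square mult.assoc del: of_real_power)
  moreover have "(norm c)\<^sup>2 = t\<^sup>2 * (norm w)\<^sup>2"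
    using t by (simp add: c_def norm_mult power_mult_distrib)
  ultimately have "2 * (t * (norm w)\<^sup>2) \<le> t\<^sup>2 * (norm w)\<^sup>2 * K"
    by simp
  then have "2 \<le> t * K"
    using t w by (simp add: power2_eq_square)
  moreover have "t * K \<le> 1" using K by (simp add: t_def)
  ultimately show False by simp
qed

text \<open>
  The relation \<open>x u = (\<Sum>k. s k * cinner u (f k) * e k)\<close>, with singular values \<open>s\<close> and
  singular vectors \<open>f\<close> and \<open>e\<close>. The bound on the remainder holds for decreasing \<open>s\<close> and
  implies convergence. Both systems are infinite even if \<open>x\<close> has finite rank; then \<open>s\<close> is
  eventually zero and the later vectors are arbitrary.
\<close>

definition schmidt ::
    "('a::complex_hilbert \<Rightarrow> 'a) \<Rightarrow> (nat \<Rightarrow> real) \<Rightarrow> (nat \<Rightarrow> 'a) \<Rightarrow> (nat \<Rightarrow> 'a) \<Rightarrow> bool"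
  where "schmidt x s e f \<longleftrightarrow> orthonormal_on UNIV e \<and> orthonormal_on UNIV f \<and> decseq s \<and> s \<longlonglongrightarrow> 0 \<and>
    clinear x \<and>
    (\<forall>n u. norm (x u - (\<Sum>k<n. (complex_of_real (s k) * cinner u (f k)) *\<^sub>C e k)) \<le> s n * norm u)"

text \<open>
  Choose \<open>f n\<close> as a maximiser of \<open>norm (x u)\<close> among the unit vectors orthogonal to the earlier
  ones. The images \<open>x (f n)\<close> are orthogonal by the first variation, their norms decrease, and
  they tend to zero since an orthogonal sequence with norms bounded below has no convergent
  subsequence.
\<close>

lemma (in infinite_dimensional_hilbert) schmidt_decomposition:
  fixes x :: "'h \<Rightarrow> 'h"
  assumes x: "compact_clinear x"
  shows "\<exists>s e f. schmidt x s e f"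
proof -
  have lin: "clinear x" using x by (simp add: compact_clinear_def)
  define R where "R m f \<longleftrightarrow> norm (f m) = 1 \<and> (\<forall>i<m. cinner (f m) (f i) = 0) \<and>
      (\<forall>u. (\<forall>i<m. cinner u (f i) = 0) \<longrightarrow> norm (x u) \<le> norm (x (f m)) * norm u)"
    for m and f :: "nat \<Rightarrow> 'h"
  have "\<exists>f. \<forall>m. R m f"
  proof (rule sequence_by_prefix_choice)
    fix n and f :: "nat \<Rightarrow> 'h" assume pre: "\<And>m. m < n \<Longrightarrow> R m f"
    have "orthonormal_on {..<n} f" using pre by (intro orthonormal_lessThanI) (auto simp: R_def)
    from compact_clinear_maximizer[OF x this] show "\<exists>g. R n (f(n := g))"
      by (auto simp: R_def)
  qed (auto simp: R_def)
  then obtain f where R: "\<And>m. R m f" by blast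
  have f1: "norm (f m) = 1" for m using R by (auto simp: R_def)
  have f: "orthonormal_on UNIV f" using R by (intro orthonormal_UNIVI) (auto simp: R_def)
  have max: "norm (x u) \<le> norm (x (f m)) * norm u" if "\<And>i. i < m \<Longrightarrow> cinner u (f i) = 0" for m u
    using R that by (auto simp: R_def)
  have xorth_less: "cinner (x (f j)) (x (f i)) = 0" if "i < j" for i j
  proof (rule maximizer_orthogonal[OF lin f1])
    show "cinner (f j) (f i) = 0" using f that by (simp add: orthonormal_onD)
    show "norm (x (f i + c *\<^sub>C f j)) \<le> norm (x (f i)) * norm (f i + c *\<^sub>C f j)" for c
      by (rule max) (use f that in \<open>auto simp: cinner_simps orthonormal_onD\<close>)
  qed
  have xorth: "cinner (x (f j)) (x (f i)) = 0" if "i \<noteq> j" for i j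
    using xorth_less[of i j] xorth_less[of j i] that cinner_eq_0_commute by (metis nat_neq_iff)
  define s where "s n = norm (x (f n))" for n
  have s0: "0 \<le> s n" for n by (simp add: s_def)
  have dec: "decseq s"
  proof (rule decseq_SucI)
    show "s (Suc n) \<le> s n" for n
      using max[of n "f (Suc n)"] f by (simp add: s_def f1 orthonormal_onD)
  qed
  have lim: "s \<longlonglongrightarrow> 0"
  proof -
    have "seq_compact (closure (x ` cball 0 1))"
      using x by (simp add: compact_clinear_def compact_imp_seq_compact)
    moreover have "x (f k) \<in> closure (x ` cball 0 1)" for k
      using f1[of k] by (intro closure_subset[THEN subsetD]) auto
    ultimately obtain l r where r: "strict_mono (r :: nat \<Rightarrow> nat)" and l: "((\<lambda>k. x (f k)) \<circ> r) \<longlonglongrightarrow> l"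
      using seq_compactE[of _ "\<lambda>k. x (f k)"] by metis
    have Cau: "Cauchy ((\<lambda>k. x (f k)) \<circ> r)" using l LIMSEQ_imp_Cauchy by blast
    show ?thesis
    proof (rule LIMSEQ_I)
      fix \<epsilon> :: real assume "0 < \<epsilon>"
      from CauchyD[OF Cau this] obtain k0 where
        k0: "\<And>j k. j \<ge> k0 \<Longrightarrow> k \<ge> k0 \<Longrightarrow> norm (x (f (r j)) - x (f (r k))) < \<epsilon>" by auto
      have "r k0 \<noteq> r (Suc k0)" using r by (metis lessI less_irrefl strict_mono_less)
      then have "(norm (x (f (r k0)) - x (f (r (Suc k0)))))\<^sup>2 = (s (r k0))\<^sup>2 + (s (r (Suc k0)))\<^sup>2"
        using pythagoras[of "x (f (r k0))" "- x (f (r (Suc k0)))"] xorth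
        by (simp add: s_def cinner_minus_right)
      then have "(s (r k0))\<^sup>2 \<le> (norm (x (f (r k0)) - x (f (r (Suc k0)))))\<^sup>2" by simp
      then have "s (r k0) \<le> norm (x (f (r k0)) - x (f (r (Suc k0))))"
        by (rule power2_le_imp_le) simp
      also have "\<dots> < \<epsilon>" by (rule k0) auto
      finally have "s n < \<epsilon>" if "n \<ge> r k0" for n
        using decseqD[OF dec that] by linarith
      then show "\<exists>no. \<forall>n\<ge>no. norm (s n - 0) < \<epsilon>" using s0 by (intro exI[of _ "r k0"]) auto
    qed
  qed
  \<comment> \<open>the normalised images \<open>x (f n)\<close>, continued arbitrarily where the image vanishes\<close>
  have "\<exists>e. orthonormal_on UNIV e \<and> (\<forall>n. s n > 0 \<longrightarrow> e n = complex_of_real (1 / s n) *\<^sub>C x (f n))"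
  proof -
    define e0 where "e0 n = complex_of_real (1 / s n) *\<^sub>C x (f n)" for n
    have e0: "orthonormal_on A e0" if "\<And>n. n \<in> A \<Longrightarrow> s n > 0" for A
      unfolding orthonormal_on_def
    proof (intro ballI)
      fix i j assume ij: "i \<in> A" "j \<in> A"
      show "cinner (e0 i) (e0 j) = (if i = j then 1 else 0)"
        using that[OF ij(1)] that[OF ij(2)] xorth[of j i]
        by (auto simp: e0_def cinner_simps cinner_self power2_eq_square simp flip: s_def)
    qed
    show ?thesis
    proof (cases "\<forall>n. s n > 0")
      case True
      then show ?thesis using e0[of UNIV] by (auto simp: e0_def)
    next
      case False
      then obtain n0 where n0: "\<not> s n0 > 0" "\<And>n. n < n0 \<Longrightarrow> s n > 0"
        using exists_least_iff[of "\<lambda>n. \<not> s n > 0"] by blast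
      obtain e where e: "orthonormal_on UNIV e" "\<And>i. i < n0 \<Longrightarrow> e i = e0 i"
        using orthonormal_extend[of n0 e0] e0[of "{..<n0}"] n0(2) by auto
      have "n < n0" if "s n > 0" for n
        using that n0(1) decseqD[OF dec, of n0 n] by (meson less_le_trans not_le_imp_less)
      then show ?thesis using e by (auto simp: e0_def)
    qed
  qed
  then obtain e where e: "orthonormal_on UNIV e"
      "\<And>n. s n > 0 \<Longrightarrow> e n = complex_of_real (1 / s n) *\<^sub>C x (f n)" by blast
  have xf: "x (f n) = complex_of_real (s n) *\<^sub>C e n" for n
  proof (cases "s n = 0")
    case True
    then show ?thesis by (simp add: s_def)
  next
    case False
    then have "s n > 0" using s0[of n] by simp
    then show ?thesis by (simp add: e(2) scaleC_scaleC)
  qed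
  have "norm (x u - (\<Sum>k<n. (complex_of_real (s k) * cinner u (f k)) *\<^sub>C e k)) \<le> s n * norm u" for n u
  proof -
    define v where "v = u - (\<Sum>k<n. cinner u (f k) *\<^sub>C f k)"
    have f': "orthonormal_on {..<n} f" using f orthonormal_on_subset by blast
    have "x u - (\<Sum>k<n. (complex_of_real (s k) * cinner u (f k)) *\<^sub>C e k) = x v"
      by (simp add: v_def clinear_diff[OF lin] clinear_sum[OF lin] clinear_scaleC[OF lin] xf scaleC_scaleC mult.commute)
    moreover have "norm (x v) \<le> s n * norm v"
      unfolding s_def v_def by (rule max) (use cinner_remainder[OF f'] in simp)
    moreover have "norm v \<le> norm u" unfolding v_def by (rule norm_remainder_le[OF f']) simp
    ultimately show ?thesis using mult_left_mono[OF _ s0[of n], of "norm v" "norm u"] by simp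
  qed
  then show ?thesis using f e(1) dec lim lin unfolding schmidt_def by blast
qed


section \<open>Singular values from the Schmidt decomposition\<close>

lemma schmidt_orthonormal: "schmidt x s e f \<Longrightarrow> orthonormal_on UNIV e" "schmidt x s e f \<Longrightarrow> orthonormal_on UNIV f"
  and schmidt_decseq: "schmidt x s e f \<Longrightarrow> decseq s"
  and schmidt_tendsto_0: "schmidt x s e f \<Longrightarrow> s \<longlonglongrightarrow> 0"
  and schmidt_clinear: "schmidt x s e f \<Longrightarrow> clinear x"
  and schmidt_remainder: "schmidt x s e f \<Longrightarrow>
    norm (x u - (\<Sum>k<n. (complex_of_real (s k) * cinner u (f k)) *\<^sub>C e k)) \<le> s n * norm u"
  by (simp_all add: schmidt_def)

lemma schmidt_nonneg: "schmidt x s e f \<Longrightarrow> 0 \<le> s n"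
  using decseq_ge[of s 0 n] schmidt_decseq schmidt_tendsto_0 by blast

lemma schmidt_bounded: "schmidt x s e f \<Longrightarrow> norm (x u) \<le> s 0 * norm u"
  using schmidt_remainder[of x s e f u 0] by simp

lemma schmidt_bounded_linear: "schmidt x s e f \<Longrightarrow> bounded_linear x"
  using clinear_bounded_linear[OF schmidt_clinear schmidt_bounded] .

lemma schmidt_sums:
  assumes "schmidt x s e f"
  shows "(\<lambda>n. \<Sum>k<n. (complex_of_real (s k) * cinner u (f k)) *\<^sub>C e k) \<longlonglongrightarrow> x u"
proof (rule LIM_zero_cancel, rule Lim_null_comparison)
  show "\<forall>\<^sub>F n in sequentially.
      norm ((\<Sum>k<n. (complex_of_real (s k) * cinner u (f k)) *\<^sub>C e k) - x u) \<le> s n * norm u"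
    using schmidt_remainder[OF assms] by (simp add: norm_minus_commute)
  show "(\<lambda>n. s n * norm u) \<longlonglongrightarrow> 0"
    using tendsto_mult_left_zero[OF schmidt_tendsto_0[OF assms]] .
qed

lemma schmidt_apply:
  assumes "schmidt x s e f"
  shows "x (f m) = complex_of_real (s m) *\<^sub>C e m"
proof -
  have "(\<Sum>k<n. (complex_of_real (s k) * cinner (f m) (f k)) *\<^sub>C e k) = complex_of_real (s m) *\<^sub>C e m"
    if "m < n" for n
  proof -
    have "(\<Sum>k<n. (complex_of_real (s k) * cinner (f m) (f k)) *\<^sub>C e k)
        = (\<Sum>k<n. if k = m then complex_of_real (s k) *\<^sub>C e k else 0)"
      using orthonormal_onD[OF schmidt_orthonormal(2)[OF assms]] by (intro sum.cong) auto
    then show ?thesis using that by simp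
  qed
  then have "\<forall>\<^sub>F n in sequentially.
      (\<Sum>k<n. (complex_of_real (s k) * cinner (f m) (f k)) *\<^sub>C e k) = complex_of_real (s m) *\<^sub>C e m"
    by (intro eventually_mono[OF eventually_gt_at_top[of m]])
  from tendsto_eventually[OF this] schmidt_sums[OF assms, of "f m"] show ?thesis
    using LIMSEQ_unique by blast
qed

text \<open>
  Orthogonality makes the partial sums a Cauchy sequence. Applied with the two systems of an
  operator exchanged or repeated, the lemma produces its adjoint and its absolute value.
\<close>

lemma schmidt_operator_exists:
  fixes e f :: "nat \<Rightarrow> 'a::complex_hilbert"
  assumes e: "orthonormal_on UNIV e" and f: "orthonormal_on UNIV f"
    and dec: "decseq s" and lim: "s \<longlonglongrightarrow> 0"
  shows "\<exists>x. schmidt x s e f"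
proof -
  have s0: "0 \<le> s n" for n using decseq_ge[OF dec lim] .
  define P where "P n u = (\<Sum>k<n. (complex_of_real (s k) * cinner u (f k)) *\<^sub>C e k)" for n u
  have P_diff: "norm (P n u - P m u) \<le> s m * norm u" if "m \<le> n" for m n u
  proof (rule power2_le_imp_le)
    have "{..<n} = {..<m} \<union> {m..<n}" using that by auto
    then have "P n u = P m u + (\<Sum>k\<in>{m..<n}. (complex_of_real (s k) * cinner u (f k)) *\<^sub>C e k)"
      unfolding P_def by (simp add: sum.union_disjoint ivl_disj_int)
    then have "(norm (P n u - P m u))\<^sup>2 = (\<Sum>k\<in>{m..<n}. (norm (complex_of_real (s k) * cinner u (f k)))\<^sup>2)"
      using norm_orthonormal_sum[OF orthonormal_on_subset[OF e], of "{m..<n}"] by simp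
    also have "\<dots> \<le> (\<Sum>k\<in>{m..<n}. (s m)\<^sup>2 * (norm (cinner u (f k)))\<^sup>2)"
      using s0 decseqD[OF dec]
      by (intro sum_mono) (simp add: norm_mult power_mult_distrib mult_right_mono power_mono)
    also have "\<dots> \<le> (s m)\<^sup>2 * (norm u)\<^sup>2"
      using bessel[OF orthonormal_on_subset[OF f], of "{m..<n}" u]
      by (simp add: mult_left_mono flip: sum_distrib_left)
    finally show "(norm (P n u - P m u))\<^sup>2 \<le> (s m * norm u)\<^sup>2"
      by (simp add: power_mult_distrib)
  qed (simp add: s0)
  have "Cauchy (\<lambda>n. P n u)" for u
  proof (rule CauchyI')
    fix \<epsilon> :: real assume "0 < \<epsilon>"
    have "(\<lambda>n. s n * norm u) \<longlonglongrightarrow> 0" using tendsto_mult_left_zero[OF lim] .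
    from LIMSEQ_D[OF this \<open>0 < \<epsilon>\<close>] obtain M where "\<And>m. m \<ge> M \<Longrightarrow> s m * norm u < \<epsilon>"
      by (auto simp: abs_less_iff)
    then show "\<exists>M. \<forall>m\<ge>M. \<forall>n>m. dist (P m u) (P n u) < \<epsilon>"
      using P_diff[of _ _ u] by (metis dist_norm norm_minus_commute le_less_trans less_imp_le)
  qed
  then have "\<exists>l. (\<lambda>n. P n u) \<longlonglongrightarrow> l" for u
    using Cauchy_convergent convergent_def by blast
  then obtain x where x: "\<And>u. (\<lambda>n. P n u) \<longlonglongrightarrow> x u" by metis
  have "clinear x"
  proof (rule clinearI)
    fix u v c
    have "P n (u + v) = P n u + P n v" "P n (c *\<^sub>C u) = c *\<^sub>C P n u" for n
      by (simp_all add: P_def cinner_simps algebra_simps scaleC_add_left sum.distrib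
          complex_vector.scale_sum_right)
    then show "x (u + v) = x u + x v" "x (c *\<^sub>C u) = c *\<^sub>C x u"
      using LIMSEQ_unique[OF x[of "u + v"]] LIMSEQ_unique[OF x[of "c *\<^sub>C u"]]
        tendsto_add[OF x[of u] x[of v]] tendsto_scaleC[OF x[of u], of c] by auto
  qed
  moreover have "norm (x u - P m u) \<le> s m * norm u" for u m
  proof (rule tendsto_upperbound)
    show "(\<lambda>n. norm (P n u - P m u)) \<longlonglongrightarrow> norm (x u - P m u)"
      by (intro tendsto_intros x)
    show "\<forall>\<^sub>F n in sequentially. norm (P n u - P m u) \<le> s m * norm u"
      using eventually_ge_at_top[of m] by (rule eventually_mono) (rule P_diff)
  qed simp
  ultimately show ?thesis using assms unfolding schmidt_def P_def by blast
qed

lemma schmidt_adjoint: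
  assumes x: "schmidt x s e f" and y: "schmidt y s f e"
  shows "cinner (x u) v = cinner u (y v)"
proof -
  have "cinner (\<Sum>k<n. (complex_of_real (s k) * cinner u (f k)) *\<^sub>C e k) v
      = cinner u (\<Sum>k<n. (complex_of_real (s k) * cinner v (e k)) *\<^sub>C f k)" for n
    unfolding cinner_sum_left cinner_sum_right
    using cinner_commute[of _ v] by (intro sum.cong) (simp_all add: cinner_simps)
  then show ?thesis
    using LIMSEQ_unique[OF tendsto_cinner_left[OF schmidt_sums[OF x]]]
      tendsto_cinner_right[OF schmidt_sums[OF y], of u v] by simp
qed

lemma schmidt_cadjoint:
  assumes x: "schmidt x s e f" and y: "schmidt y s f e"
  shows "cadjoint x = y"
  unfolding cadjoint_def
proof (rule the_equality)
  show "\<forall>u v. cinner (x u) v = cinner u (y v)" using schmidt_adjoint[OF x y] by blast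
  fix z assume z: "\<forall>u v. cinner (x u) v = cinner u (z v)"
  have "z v = y v" for v
  proof (rule cinner_eqI)
    have "cinner u (z v) = cinner u (y v)" for u using z schmidt_adjoint[OF x y] by metis
    then show "cinner (z v) u = cinner (y v) u" for u by (metis cinner_commute)
  qed
  then show "z = y" by blast
qed

lemma schmidt_positive:
  assumes p: "schmidt p s f f"
  shows "positive_op p"
  unfolding positive_op_def bounded_clinear_def
proof (intro conjI allI)
  show "clinear p" by (rule schmidt_clinear[OF p])
  show "bounded_linear p" by (rule schmidt_bounded_linear[OF p])
  fix u
  have "cinner (\<Sum>k<n. (complex_of_real (s k) * cinner u (f k)) *\<^sub>C f k) u
      = complex_of_real (\<Sum>k<n. s k * (norm (cinner u (f k)))\<^sup>2)" for n
    unfolding cinner_sum_left of_real_sum using cinner_commute[of _ u]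
    by (intro sum.cong) (simp_all add: cinner_simps complex_norm_square mult.assoc del: of_real_power)
  moreover have "complex_of_real (\<Sum>k<n. s k * (norm (cinner u (f k)))\<^sup>2) \<in> \<real>\<^sub>\<ge>\<^sub>0" for n
    unfolding nonneg_Reals_of_real_iff using schmidt_nonneg[OF p] by (simp add: sum_nonneg)
  ultimately show "cinner (p u) u \<in> \<real>\<^sub>\<ge>\<^sub>0"
    by (intro closed_sequentially[OF closed_nonneg_Reals_complex _
          tendsto_cinner_left[OF schmidt_sums[OF p]]]) simp
qed

text \<open>
  The operators \<open>y \<circ> x\<close> for \<open>y\<close> the adjoint of \<open>x\<close>, and \<open>p \<circ> p\<close> for \<open>p\<close> the absolute value,
  both have this expansion with \<open>g = f\<close>, so they coincide.
\<close>

lemma schmidt_compose_sums: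
  assumes x: "schmidt x s e f" and y: "schmidt y s g e"
  shows "(\<lambda>n. \<Sum>k<n. (complex_of_real ((s k)\<^sup>2) * cinner u (f k)) *\<^sub>C g k) \<longlonglongrightarrow> y (x u)"
proof -
  have "y (\<Sum>k<n. (complex_of_real (s k) * cinner u (f k)) *\<^sub>C e k)
      = (\<Sum>k<n. (complex_of_real ((s k)\<^sup>2) * cinner u (f k)) *\<^sub>C g k)" for n
    by (simp add: clinear_sum[OF schmidt_clinear[OF y]] clinear_scaleC[OF schmidt_clinear[OF y]]
        schmidt_apply[OF y] scaleC_scaleC power2_eq_square mult.commute mult.left_commute)
  then show ?thesis
    using bounded_linear.tendsto[OF schmidt_bounded_linear[OF y] schmidt_sums[OF x], of u]
    by (simp del: of_real_power)
qed

lemma positive_op_symmetric: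
  assumes "positive_op p"
  shows "cinner (p u) v = cinner u (p v)"
proof -
  have lin: "clinear p" using assms by (simp add: positive_op_def bounded_clinear_def)
  have im: "Im (cinner (p w) w) = 0" for w
    using assms by (simp add: positive_op_def complex_nonneg_Reals_iff)
  have "Im (cinner (p u) v) + Im (cinner (p v) u) = 0"
    using im[of "u + v"] im[of u] im[of v] by (simp add: clinear_add[OF lin] cinner_simps)
  moreover have "Re (cinner (p v) u) - Re (cinner (p u) v) = 0"
    using im[of "u + \<i> *\<^sub>C v"] im[of u] im[of v]
    by (simp add: clinear_add[OF lin] clinear_scaleC[OF lin] cinner_simps algebra_simps)
  moreover have "cinner u (p v) = cnj (cinner (p v) u)" by (rule cinner_commute)
  ultimately show ?thesis by (simp add: complex_eq_iff)
qed

text \<open>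
  A positive square root acts as \<open>\<surd>\<lambda>\<close> on eigenvectors of its square for the eigenvalue \<open>\<lambda>\<close>,
  and for symmetric \<open>r\<close> the norm of \<open>r w\<close> depends only on \<open>r \<circ> r\<close>; the second fact carries the
  estimate for the tail of the eigenvector expansion from one root to the other.
\<close>

lemma positive_sqrt_unique:
  assumes p: "schmidt p s f f" and r: "positive_op r" and eq: "r \<circ> r = p \<circ> p"
  shows "r = p"
proof
  fix u
  have lin: "clinear r" using r by (simp add: positive_op_def bounded_clinear_def)
  have plin: "clinear p" by (rule schmidt_clinear[OF p])
  have rr: "r (r w) = p (p w)" for w using eq by (metis comp_apply)
  have norm_eq: "norm (r w) = norm (p w)" for w
  proof -
    have "cinner (r w) (r w) = cinner (p w) (p w)"
      unfolding positive_op_symmetric[OF r, of w "r w"]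
        positive_op_symmetric[OF schmidt_positive[OF p], of w "p w"] rr ..
    then show ?thesis by (simp add: norm_eq_sqrt_cinner)
  qed
  have rf: "r (f k) = complex_of_real (s k) *\<^sub>C f k" for k
  proof -
    \<comment> \<open>\<open>v\<close> would be an eigenvector of \<open>r\<close> for the eigenvalue \<open>- s k\<close>\<close>
    define v where "v = r (f k) - complex_of_real (s k) *\<^sub>C f k"
    have "r v = - (complex_of_real (s k) *\<^sub>C v)"
      by (simp add: v_def clinear_diff[OF lin] clinear_scaleC[OF lin] rr schmidt_apply[OF p]
          clinear_scaleC[OF plin] complex_vector.scale_right_diff_distrib)
    then have "cinner (r v) v = complex_of_real (- (s k * (norm v)\<^sup>2))"
      by (simp add: cinner_simps cinner_self)
    moreover have "cinner (r v) v \<in> \<real>\<^sub>\<ge>\<^sub>0" using r by (simp add: positive_op_def)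
    ultimately have "s k * (norm v)\<^sup>2 \<le> 0"
      by (simp only: nonneg_Reals_of_real_iff)
    then have "s k = 0 \<or> v = 0"
      using schmidt_nonneg[OF p, of k] by (auto simp: mult_le_0_iff)
    then show ?thesis
    proof
      assume "s k = 0"
      then show ?thesis using norm_eq[of "f k"] by (simp add: schmidt_apply[OF p])
    qed (simp add: v_def)
  qed
  have tail: "norm (r u - (\<Sum>k<n. (complex_of_real (s k) * cinner u (f k)) *\<^sub>C f k)) \<le> s n * norm u" for n
  proof -
    define w where "w = u - (\<Sum>k<n. cinner u (f k) *\<^sub>C f k)"
    have "r u - (\<Sum>k<n. (complex_of_real (s k) * cinner u (f k)) *\<^sub>C f k) = r w"
      by (simp add: w_def clinear_diff[OF lin] clinear_sum[OF lin] clinear_scaleC[OF lin] rf scaleC_scaleC mult.commute)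
    moreover have "p u - (\<Sum>k<n. (complex_of_real (s k) * cinner u (f k)) *\<^sub>C f k) = p w"
      by (simp add: w_def clinear_diff[OF plin] clinear_sum[OF plin] clinear_scaleC[OF plin]
          schmidt_apply[OF p] scaleC_scaleC mult.commute)
    ultimately show ?thesis using norm_eq schmidt_remainder[OF p, of u n] by simp
  qed
  have "(\<lambda>n. \<Sum>k<n. (complex_of_real (s k) * cinner u (f k)) *\<^sub>C f k) \<longlonglongrightarrow> r u"
  proof (rule LIM_zero_cancel, rule Lim_null_comparison)
    show "\<forall>\<^sub>F n in sequentially.
        norm ((\<Sum>k<n. (complex_of_real (s k) * cinner u (f k)) *\<^sub>C f k) - r u) \<le> s n * norm u"
      using tail by (simp add: norm_minus_commute)
    show "(\<lambda>n. s n * norm u) \<longlonglongrightarrow> 0"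
      using tendsto_mult_left_zero[OF schmidt_tendsto_0[OF p]] .
  qed
  then show "r u = p u" using schmidt_sums[OF p] LIMSEQ_unique by blast
qed

text \<open>
  The absolute value replaces the left singular vectors by the right ones.
\<close>

lemma schmidt_abs_op:
  assumes x: "schmidt x s e f"
  shows "schmidt (abs_op x) s f f"
proof -
  note e = schmidt_orthonormal(1)[OF x] and f = schmidt_orthonormal(2)[OF x]
    and s = schmidt_decseq[OF x] schmidt_tendsto_0[OF x]
  obtain y where y: "schmidt y s f e" using schmidt_operator_exists[OF f e s] by blast
  obtain p where p: "schmidt p s f f" using schmidt_operator_exists[OF f f s] by blast
  have sq: "p \<circ> p = y \<circ> x"
    using LIMSEQ_unique[OF schmidt_compose_sums[OF p p] schmidt_compose_sums[OF x y]] by (auto simp: fun_eq_iff)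
  have "sqrt_op (y \<circ> x) = p"
    unfolding sqrt_op_def
  proof (rule the_equality)
    show "positive_op p \<and> p \<circ> p = y \<circ> x" using schmidt_positive[OF p] sq by simp
    show "r = p" if "positive_op r \<and> r \<circ> r = y \<circ> x" for r
      by (rule positive_sqrt_unique[OF p]) (simp_all add: that sq)
  qed
  then show ?thesis using p by (simp add: abs_op_def schmidt_cadjoint[OF x y])
qed

lemma schmidt_finite_level:
  assumes p: "schmidt x s e f" and "0 < t"
  shows "finite {k. s k = t}"
proof -
  from LIMSEQ_D[OF schmidt_tendsto_0[OF p] \<open>0 < t\<close>] obtain N where "\<And>k. k \<ge> N \<Longrightarrow> s k < t" by fastforce
  then have "{k. s k = t} \<subseteq> {..<N}" by (auto simp: not_less[symmetric])
  then show ?thesis by (rule finite_subset) simp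
qed

text \<open>
  An eigenvector for \<open>t\<close> is orthogonal to every \<open>f k\<close> with \<open>s k \<noteq> t\<close>, so its expansion only
  involves the finitely many \<open>f k\<close> with \<open>s k = t\<close>.
\<close>

lemma schmidt_eigenspace:
  assumes p: "schmidt p s f f" and t: "0 < t"
  shows "eigenspace p (complex_of_real t) = complex_vector.span (f ` {k. s k = t})"
proof
  let ?K = "{k. s k = t}"
  note f = schmidt_orthonormal(2)[OF p]
  have sym: "cinner (p u) v = cinner u (p v)" for u v
    by (rule positive_op_symmetric[OF schmidt_positive[OF p]])
  show "eigenspace p (complex_of_real t) \<subseteq> complex_vector.span (f ` ?K)"
  proof
    fix u assume "u \<in> eigenspace p (complex_of_real t)"
    then have pu: "p u = complex_of_real t *\<^sub>C u" by (simp add: eigenspace_def)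
    have zero: "cinner u (f k) = 0" if "s k \<noteq> t" for k
      using sym[of u "f k"] that by (simp add: pu schmidt_apply[OF p] cinner_simps)
    obtain N where N: "?K \<subseteq> {..<N}"
      using schmidt_finite_level[OF p t] finite_nat_iff_bounded by blast
    have "(\<Sum>k<n. (complex_of_real (s k) * cinner u (f k)) *\<^sub>C f k)
        = (\<Sum>k\<in>?K. (complex_of_real (s k) * cinner u (f k)) *\<^sub>C f k)" if "N \<le> n" for n
      by (rule sum.mono_neutral_right) (use N that zero in auto)
    then have "\<forall>\<^sub>F n in sequentially. (\<Sum>k<n. (complex_of_real (s k) * cinner u (f k)) *\<^sub>C f k)
        = (\<Sum>k\<in>?K. (complex_of_real (s k) * cinner u (f k)) *\<^sub>C f k)"
      by (intro eventually_mono[OF eventually_ge_at_top[of N]])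
    from LIMSEQ_unique[OF schmidt_sums[OF p] tendsto_eventually[OF this]]
    have "complex_of_real t *\<^sub>C u = (\<Sum>k\<in>?K. (complex_of_real (s k) * cinner u (f k)) *\<^sub>C f k)"
      by (simp add: pu)
    also have "\<dots> \<in> complex_vector.span (f ` ?K)"
      by (intro complex_vector.span_sum complex_vector.span_scale complex_vector.span_base) simp
    finally have "complex_of_real (1 / t) *\<^sub>C complex_of_real t *\<^sub>C u \<in> complex_vector.span (f ` ?K)"
      by (rule complex_vector.span_scale)
    then show "u \<in> complex_vector.span (f ` ?K)" using t by (simp add: scaleC_scaleC)
  qed
  show "complex_vector.span (f ` ?K) \<subseteq> eigenspace p (complex_of_real t)"
  proof (rule complex_vector.span_minimal)
    show "f ` ?K \<subseteq> eigenspace p (complex_of_real t)"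
      by (auto simp: eigenspace_def schmidt_apply[OF p])
    show "complex_vector.subspace (eigenspace p (complex_of_real t))"
      unfolding complex_vector.subspace_def eigenspace_def using schmidt_clinear[OF p]
      by (auto simp: clinear_zero clinear_add clinear_scaleC scaleC_add_right scaleC_scaleC mult.commute)
  qed
qed

lemma orthonormal_independent:
  assumes f: "orthonormal_on UNIV f" and "finite K"
  shows "complex_vector.independent (f ` K)" "inj_on f K"
proof -
  show inj: "inj_on f K"
  proof (rule inj_onI)
    fix i j assume "f i = f j"
    then have "cinner (f i) (f j) = 1" using f by (simp add: orthonormal_onD)
    then show "i = j" using f by (simp add: orthonormal_onD split: if_splits)
  qed
  show "complex_vector.independent (f ` K)"
  proof (rule complex_vector.independent_if_scalars_zero)
    fix c v assume z: "(\<Sum>w\<in>f ` K. c w *\<^sub>C w) = 0" and "v \<in> f ` K"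
    then obtain j where j: "j \<in> K" "v = f j" by blast
    have "(\<Sum>i\<in>K. c (f i) *\<^sub>C f i) = 0" using z inj by (simp add: sum.reindex)
    moreover have "cinner (\<Sum>i\<in>K. c (f i) *\<^sub>C f i) (f j) = c (f j)"
      using orthonormal_on_subset[OF f] assms(2) j(1) by (intro cinner_orthonormal_sum) auto
    ultimately show "c v = 0" using j by simp
  qed (use assms in simp)
qed

text \<open>
  This is the step in the proof that a decreasing sequence is determined by how often it takes
  each positive value: if the sequences agree before \<open>n\<close> and \<open>s n\<close> is larger, then \<open>t\<close> takes
  the value \<open>s n\<close> only before \<open>n\<close>, hence less often than \<open>s\<close>.
\<close>

lemma decseq_eq_if_levels_eq:
  fixes s t :: "nat \<Rightarrow> real"
  assumes s: "decseq s" and t: "decseq t" "\<And>n. 0 \<le> t n"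
    and fin: "\<And>c. 0 < c \<Longrightarrow> finite {n. s n = c}" "\<And>c. 0 < c \<Longrightarrow> finite {n. t n = c}"
    and card: "\<And>c. 0 < c \<Longrightarrow> card {n. s n = c} = card {n. t n = c}"
    and eq: "\<And>k. k < n \<Longrightarrow> s k = t k"
  shows "\<not> t n < s n"
proof
  assume less: "t n < s n"
  define c where "c = s n"
  have "0 < c" using less t(2)[of n] by (simp add: c_def)
  have "k < n" if "t k = c" for k
    using that less decseqD[OF t(1), of n k] by (simp add: c_def) (meson leD leI less_le_trans)
  then have "{k. t k = c} \<subset> {k. s k = c}" using eq less by (auto simp: c_def)
  from psubset_card_mono[OF fin(1)[OF \<open>0 < c\<close>] this] card[OF \<open>0 < c\<close>] show False by simp
qed

text \<open>
  The multiplicities of the eigenvalues of the absolute value are the sizes of the level sets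
  of \<open>s\<close>.
\<close>

lemma schmidt_singular_values:
  assumes x: "schmidt x s e f"
  shows "singular_values x = s"
  unfolding singular_values_def
proof (rule the_equality)
  note p = schmidt_abs_op[OF x] and f = schmidt_orthonormal(2)[OF x]
  have dim: "card {n. s n = t} = complex_vector.dim (eigenspace (abs_op x) (complex_of_real t))"
    if "0 < t" for t
    using orthonormal_independent[OF f schmidt_finite_level[OF x that]]
    by (simp add: schmidt_eigenspace[OF p that] complex_vector.dim_eq_card_independent card_image)
  then show "decseq s \<and> (\<forall>n. 0 \<le> s n) \<and> (\<forall>t>0. finite {n. s n = t} \<and>
      card {n. s n = t} = complex_vector.dim (eigenspace (abs_op x) (complex_of_real t)))"
    using schmidt_decseq[OF x] schmidt_nonneg[OF x] schmidt_finite_level[OF x] by auto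
  fix r assume r: "decseq r \<and> (\<forall>n. 0 \<le> r n) \<and> (\<forall>t>0. finite {n. r n = t} \<and>
      card {n. r n = t} = complex_vector.dim (eigenspace (abs_op x) (complex_of_real t)))"
  have "r n = s n" for n
  proof (induction n rule: less_induct)
    case (less n)
    have "\<not> r n < s n"
      by (rule decseq_eq_if_levels_eq[of s r n])
        (use r less schmidt_decseq[OF x] schmidt_finite_level[OF x] dim in auto)
    moreover have "\<not> s n < r n"
      by (rule decseq_eq_if_levels_eq[of r s n])
        (use r less schmidt_decseq[OF x] schmidt_finite_level[OF x] schmidt_nonneg[OF x] dim in auto)
    ultimately show ?case by simp
  qed
  then show "r = s" by blast
qed


section \<open>Duality for symmetric sequence spaces\<close>

text \<open>
  An exceptional set \<open>F\<close> for \<open>y\<close> pulls back along \<open>p\<close> to one of the same size for \<open>x\<close>.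
\<close>

lemma rearrangement_mono:
  fixes x y :: "nat \<Rightarrow> real"
  assumes y: "Bseq y" and p: "bij p" and le: "\<And>k. \<bar>x k\<bar> \<le> \<bar>y (p k)\<bar>"
  shows "rearrangement x n \<le> rearrangement y n"
proof -
  obtain K where K: "\<And>k. \<bar>y k\<bar> \<le> K" using y by (auto simp: Bseq_def)
  have bdd_y: "bdd_above ((\<lambda>k. \<bar>y k\<bar>) ` A)" for A using K by (intro bdd_aboveI2)
  have bdd_x: "bdd_above ((\<lambda>k. \<bar>x k\<bar>) ` A)" for A using order_trans[OF le K] by (intro bdd_aboveI2)
  have nonempty: "- F \<noteq> {}" if "finite F" for F :: "nat set"
    using ex_new_if_finite[OF infinite_UNIV_nat that] by blast
  show ?thesis unfolding rearrangement_def
  proof (rule cINF_mono)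
    have "{} \<in> {F :: nat set. finite F \<and> card F \<le> n}" by simp
    then show "{F :: nat set. finite F \<and> card F \<le> n} \<noteq> {}" by blast
    show "bdd_below ((\<lambda>F. SUP k\<in>- F. \<bar>x k\<bar>) ` {F. finite F \<and> card F \<le> n})"
    proof (rule bdd_belowI2)
      fix F assume "F \<in> {F :: nat set. finite F \<and> card F \<le> n}"
      then obtain k where "k \<in> - F" using nonempty[of F] by auto
      show "0 \<le> (SUP k\<in>- F. \<bar>x k\<bar>)"
        by (rule order_trans[OF abs_ge_zero cSUP_upper[OF \<open>k \<in> - F\<close> bdd_x]])
    qed
    fix F assume F: "F \<in> {F :: nat set. finite F \<and> card F \<le> n}"
    have fin: "finite (p -` F)" "card (p -` F) \<le> n"
      using F p finite_vimageI[of F p] card_vimage_inj[of p F] by (auto simp: bij_def)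
    have "(SUP k\<in>- (p -` F). \<bar>x k\<bar>) \<le> (SUP k\<in>- F. \<bar>y k\<bar>)"
      by (rule cSUP_mono[OF nonempty[OF fin(1)] bdd_y]) (use le in force)
    then show "\<exists>G\<in>{F. finite F \<and> card F \<le> n}. (SUP k\<in>- G. \<bar>x k\<bar>) \<le> (SUP k\<in>- F. \<bar>y k\<bar>)"
      using fin by blast
  qed
qed

lemma exists_sorting_permutation:
  fixes g :: "nat \<Rightarrow> real"
  shows "\<exists>p. p permutes {..<n} \<and> (\<forall>i j. i \<le> j \<longrightarrow> j < n \<longrightarrow> g (p j) \<le> g (p i))"
proof -
  define xs where "xs = sort_key (\<lambda>i. - g i) [0..<n]"
  have "mset xs = mset [0..<n]" by (simp add: xs_def)
  then obtain p where p: "p permutes {..<length [0..<n]}" "permute_list p [0..<n] = xs"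
    by (rule mset_eq_permutation)
  have len: "length xs = n" by (simp add: xs_def)
  have nth: "xs ! i = p i" if "i < n" for i
  proof -
    have "p i < n" using p(1) that by (metis diff_zero length_upt lessThan_iff permutes_in_image)
    then show ?thesis using permute_list_nth[OF p(1)] that p(2) by simp
  qed
  have "sorted (map (\<lambda>i. - g i) xs)" by (simp add: xs_def)
  then have "g (p j) \<le> g (p i)" if "i \<le> j" "j < n" for i j
    using sorted_nth_mono[of "map (\<lambda>i. - g i) xs" i j] that len nth by simp
  then show ?thesis using p(1) by (intro exI[of _ p]) simp
qed

text \<open>
  Summation by parts expresses the difference of the two sides through the partial sums of
  \<open>s - t\<close>, with the non-negative coefficients \<open>w i - w (i + 1)\<close> and \<open>w (n - 1)\<close>.
\<close>

lemma sum_mult_decreasing_mono: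
  fixes w t s :: "nat \<Rightarrow> real"
  assumes dec: "\<And>i j. i \<le> j \<Longrightarrow> j < n \<Longrightarrow> w j \<le> w i" and nonneg: "\<And>i. i < n \<Longrightarrow> 0 \<le> w i"
    and le: "\<And>m. m \<le> n \<Longrightarrow> (\<Sum>i<m. t i) \<le> (\<Sum>i<m. s i)"
  shows "(\<Sum>i<n. w i * t i) \<le> (\<Sum>i<n. w i * s i)"
proof -
  define D where "D m = (\<Sum>i<m. s i - t i)" for m
  have D: "0 \<le> D m" if "m \<le> n" for m using le[OF that] by (simp add: D_def sum_subtractf)
  have step: "w m * D (Suc m) \<le> (\<Sum>i<Suc m. w i * (s i - t i))" if "m < n" for m
    using that
  proof (induction m)
    case (Suc m)
    have "w (Suc m) * D (Suc m) \<le> w m * D (Suc m)"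
      using Suc.prems by (intro mult_right_mono dec D) auto
    then show ?case using Suc by (simp add: D_def algebra_simps)
  qed (simp add: D_def)
  have "0 \<le> (\<Sum>i<n. w i * (s i - t i))"
  proof (cases n)
    case (Suc m)
    have "0 \<le> w m * D n" using nonneg[of m] D[of n] Suc by (intro mult_nonneg_nonneg) auto
    also have "\<dots> \<le> (\<Sum>i<n. w i * (s i - t i))" using step[of m] Suc by simp
    finally show ?thesis .
  qed simp
  then show ?thesis by (simp add: algebra_simps sum_subtractf)
qed

locale fatou_sequence_space =
  fixes E :: "(nat \<Rightarrow> real) set" and N :: "(nat \<Rightarrow> real) \<Rightarrow> real"
  assumes symmetric: "banach_symmetric_seq_space E N" and fatou: "fatou_property E N"
begin

lemma add_mem: "x \<in> E \<Longrightarrow> y \<in> E \<Longrightarrow> (\<lambda>n. x n + y n) \<in> E"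
  and norm_add_le: "x \<in> E \<Longrightarrow> y \<in> E \<Longrightarrow> N (\<lambda>n. x n + y n) \<le> N x + N y"
  and scale_mem: "x \<in> E \<Longrightarrow> (\<lambda>n. c * x n) \<in> E"
  and norm_scale: "x \<in> E \<Longrightarrow> N (\<lambda>n. c * x n) = \<bar>c\<bar> * N x"
  and zero_mem: "(\<lambda>n. 0) \<in> E"
  and norm_zero: "N (\<lambda>n. 0) = 0"
  using symmetric by (auto simp: banach_symmetric_seq_space_def normed_seq_space_def)

text \<open>
  The only way in which rearrangement invariance is used: the norm is monotone in absolute
  values and invariant under permutations of the coordinates.
\<close>

lemma solid:
  assumes y: "y \<in> E" and p: "bij p" and le: "\<And>k. \<bar>x k\<bar> \<le> \<bar>y (p k)\<bar>"
  shows "x \<in> E" "N x \<le> N y"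
proof -
  have "Bseq y" using y symmetric by (auto simp: banach_symmetric_seq_space_def l_infty_def)
  then obtain K where "\<And>k. \<bar>y k\<bar> \<le> K" by (auto simp: Bseq_def)
  then have "Bseq x" using order_trans[OF le] by (intro BseqI'[of _ K]) simp
  then show "x \<in> E" "N x \<le> N y"
    using symmetric y rearrangement_mono[OF \<open>Bseq y\<close> p le]
    by (auto simp: banach_symmetric_seq_space_def l_infty_def)
qed

definition unit_seq :: "nat \<Rightarrow> nat \<Rightarrow> real"
  where "unit_seq j = (\<lambda>n. if n = j then 1 else 0)"

lemma unit_seq_mem: "unit_seq j \<in> E"
proof -
  obtain y where y: "y \<in> E" "y \<noteq> (\<lambda>n. 0)"
    using symmetric zero_mem by (auto simp: banach_symmetric_seq_space_def)
  then obtain k where k: "y k \<noteq> 0" by auto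
  show ?thesis
    by (rule solid(1)[OF scale_mem[OF y(1), of "1 / y k"] bij_transpose[of j k]])
      (use k in \<open>auto simp: unit_seq_def\<close>)
qed

lemma norm_unit_seq: "N (unit_seq j) = 1"
proof -
  have 0: "N (unit_seq 0) = 1"
    using symmetric by (simp add: banach_symmetric_seq_space_def unit_seq_def)
  have "N (unit_seq j) \<le> N (unit_seq i)" for i j
    by (rule solid(2)[OF unit_seq_mem bij_transpose[of i j]])
      (auto simp: unit_seq_def)
  from this[of j 0] this[of 0 j] show ?thesis using 0 by simp
qed

definition truncate :: "nat \<Rightarrow> (nat \<Rightarrow> real) \<Rightarrow> nat \<Rightarrow> real"
  where "truncate n x = (\<lambda>k. if k < n then x k else 0)"

lemma truncate_mem: "truncate n x \<in> E"
proof (induction n)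
  case 0
  then show ?case using zero_mem by (simp add: truncate_def)
next
  case (Suc n)
  have "truncate (Suc n) x = (\<lambda>k. truncate n x k + x n * unit_seq n k)"
    by (auto simp: truncate_def unit_seq_def fun_eq_iff less_Suc_eq)
  then show ?case using add_mem[OF Suc scale_mem[OF unit_seq_mem]] by simp
qed

lemma norm_truncate_le: "x \<in> E \<Longrightarrow> N (truncate n x) \<le> N x"
  by (rule solid(2)[OF _ bij_id]) (auto simp: truncate_def)

text \<open>
  Functionals on the first \<open>n\<close> coordinates of norm at most \<open>1\<close>. Because truncation does not
  increase the norm, testing them on all of \<open>E\<close> is the same as testing them on sequences that
  vanish from \<open>n\<close> on.
\<close>

definition dual_on :: "nat \<Rightarrow> (nat \<Rightarrow> real) \<Rightarrow> bool"
  where "dual_on n b \<longleftrightarrow> (\<forall>c\<in>E. (\<Sum>i<n. b i * c i) \<le> N c)"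

text \<open>
  The Hahn--Banach theorem for the coordinate subspaces. The functional that is prescribed on the
  multiples of the truncation of \<open>a\<close> is extended by one coordinate at a time; in the step, the
  new coefficient \<open>\<beta>\<close> lies between the lower and the upper bounds that sublinearity of \<open>N\<close>
  imposes, and \<open>cross\<close> says that these do not contradict each other.
\<close>

lemma norming_extension:
  "\<exists>b. \<forall>c t. (\<Sum>i<m. b i * c i) + t * N (truncate n a) \<le> N (\<lambda>k. truncate m c k + t * truncate n a k)"
proof (induction m)
  case 0
  have "t * N (truncate n a) \<le> N (\<lambda>k. t * truncate n a k)" for t
    unfolding norm_scale[OF truncate_mem]
    using symmetric truncate_mem by (intro mult_right_mono) (auto simp: banach_symmetric_seq_space_def normed_seq_space_def)
  then show ?case by (simp add: truncate_def)
next
  case (Suc m)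
  define A where "A = truncate n a"
  define v where "v c t = (\<lambda>k. truncate m c k + t * A k)" for c t
  obtain b where b: "\<And>c t. (\<Sum>i<m. b i * c i) + t * N A \<le> N (v c t)"
    using Suc.IH unfolding A_def v_def by blast
  define F where "F c t = (\<Sum>i<m. b i * c i) + t * N A" for c t
  have v_mem: "v c t \<in> E" for c t
    unfolding v_def A_def by (intro add_mem scale_mem truncate_mem)
  have vu_mem: "(\<lambda>k. v c t k + r * unit_seq m k) \<in> E" for c t r
    by (intro add_mem scale_mem v_mem unit_seq_mem)
  have F_scale: "F (\<lambda>i. r * c i) (r * t) = r * F c t" for r c t
    by (simp add: F_def sum_distrib_left algebra_simps)
  have v_scale: "v (\<lambda>i. r * c i) (r * t) = (\<lambda>k. r * v c t k)" for r c t
    by (auto simp: v_def truncate_def algebra_simps)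
  have cross: "F c t - N (\<lambda>k. v c t k + (-1) * unit_seq m k)
      \<le> N (\<lambda>k. v c' t' k + 1 * unit_seq m k) - F c' t'" for c t c' t'
  proof -
    have "F c t + F c' t' = F (\<lambda>i. c i + c' i) (t + t')"
      by (simp add: F_def algebra_simps sum.distrib)
    also have "\<dots> \<le> N (v (\<lambda>i. c i + c' i) (t + t'))" unfolding F_def by (rule b)
    also have "v (\<lambda>i. c i + c' i) (t + t')
        = (\<lambda>k. (v c t k + (-1) * unit_seq m k) + (v c' t' k + 1 * unit_seq m k))"
      by (auto simp: v_def truncate_def algebra_simps)
    also have "N \<dots> \<le> N (\<lambda>k. v c t k + (-1) * unit_seq m k) + N (\<lambda>k. v c' t' k + 1 * unit_seq m k)"
      by (rule norm_add_le[OF vu_mem vu_mem])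
    finally show ?thesis by simp
  qed
  define \<beta> where "\<beta> = (SUP (c, t)\<in>UNIV. F c t - N (\<lambda>k. v c t k + (-1) * unit_seq m k))"
  have bdd: "bdd_above (range (\<lambda>(c, t). F c t - N (\<lambda>k. v c t k + (-1) * unit_seq m k)))"
    using cross[of _ _ "\<lambda>_. 0" 0] by (intro bdd_aboveI2) (auto simp: case_prod_beta)
  have lower: "F c t - N (\<lambda>k. v c t k + (-1) * unit_seq m k) \<le> \<beta>" for c t
    using cSUP_upper[OF UNIV_I[of "(c, t)"] bdd] by (simp add: \<beta>_def)
  have upper: "\<beta> \<le> N (\<lambda>k. v c t k + 1 * unit_seq m k) - F c t" for c t
    unfolding \<beta>_def by (rule cSUP_least) (use cross in auto)
  have main: "F c t + r * \<beta> \<le> N (\<lambda>k. v c t k + r * unit_seq m k)" for c t r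
  proof -
    consider "r = 0" | "0 < r" | "r < 0" by linarith
    then show ?thesis
    proof cases
      case 1
      then show ?thesis using b[of c t] by (simp add: F_def)
    next
      case 2
      define c' t' where "c' = (\<lambda>i. (1 / r) * c i)" and "t' = (1 / r) * t"
      have "F c t + r * \<beta> = r * (F c' t' + \<beta>)"
        using 2 F_scale[of "1 / r" c t] by (simp add: c'_def t'_def field_simps)
      also have "\<dots> \<le> r * N (\<lambda>k. v c' t' k + 1 * unit_seq m k)"
        using 2 upper[of c' t'] by (intro mult_left_mono) auto
      also have "\<dots> = N (\<lambda>k. r * (v c' t' k + 1 * unit_seq m k))"
        using 2 by (subst norm_scale[OF vu_mem]) simp
      also have "(\<lambda>k. r * (v c' t' k + 1 * unit_seq m k)) = (\<lambda>k. v c t k + r * unit_seq m k)"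
        using 2 v_scale[of "1 / r" c t] by (auto simp: c'_def t'_def fun_eq_iff algebra_simps)
      finally show ?thesis .
    next
      case 3
      define q where "q = - r"
      have q: "0 < q" using 3 by (simp add: q_def)
      define c' t' where "c' = (\<lambda>i. (1 / q) * c i)" and "t' = (1 / q) * t"
      have "F c t + r * \<beta> = q * (F c' t' - \<beta>)"
        using q F_scale[of "1 / q" c t] by (simp add: c'_def t'_def q_def field_simps)
      also have "\<dots> \<le> q * N (\<lambda>k. v c' t' k + (-1) * unit_seq m k)"
        using q lower[of c' t'] by (intro mult_left_mono) auto
      also have "\<dots> = N (\<lambda>k. q * (v c' t' k + (-1) * unit_seq m k))"
        using q by (subst norm_scale[OF vu_mem]) simp
      also have "(\<lambda>k. q * (v c' t' k + (-1) * unit_seq m k)) = (\<lambda>k. v c t k + r * unit_seq m k)"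
        using q v_scale[of "1 / q" c t] by (auto simp: c'_def t'_def q_def fun_eq_iff algebra_simps)
      finally show ?thesis .
    qed
  qed
  have "(\<Sum>i<Suc m. (b(m := \<beta>)) i * c i) + t * N A \<le> N (\<lambda>k. truncate (Suc m) c k + t * A k)" for c t
  proof -
    have "(\<Sum>i<Suc m. (b(m := \<beta>)) i * c i) + t * N A = F c t + c m * \<beta>"
      by (simp add: F_def)
    also have "\<dots> \<le> N (\<lambda>k. v c t k + c m * unit_seq m k)" by (rule main)
    also have "(\<lambda>k. v c t k + c m * unit_seq m k) = (\<lambda>k. truncate (Suc m) c k + t * A k)"
      by (auto simp: v_def truncate_def unit_seq_def less_Suc_eq)
    finally show ?thesis .
  qed
  then show ?case unfolding A_def by blast
qed

lemma norming_functional: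
  "\<exists>b. dual_on n b \<and> N (truncate n a) \<le> (\<Sum>i<n. b i * a i)"
proof -
  obtain b where b: "\<And>c t. (\<Sum>i<n. b i * c i) + t * N (truncate n a)
      \<le> N (\<lambda>k. truncate n c k + t * truncate n a k)"
    using norming_extension[of n n a] by blast
  have "dual_on n b"
    unfolding dual_on_def
  proof
    fix c assume "c \<in> E"
    then show "(\<Sum>i<n. b i * c i) \<le> N c"
      using b[of c 0] norm_truncate_le[of c n] by simp
  qed
  moreover have "N (truncate n a) \<le> (\<Sum>i<n. b i * a i)"
  proof -
    have "(\<lambda>k. truncate n (\<lambda>i. - a i) k + 1 * truncate n a k) = (\<lambda>k. 0)"
      by (auto simp: truncate_def)
    then show ?thesis using b[of "\<lambda>i. - a i" 1] norm_zero by (simp add: sum_negf)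
  qed
  ultimately show ?thesis by blast
qed

lemma dual_on_permute:
  assumes b: "dual_on n b" and p: "p permutes {..<n}"
  shows "dual_on n (\<lambda>i. \<bar>b (p i)\<bar>)"
  unfolding dual_on_def
proof
  fix c assume c: "c \<in> E"
  define c' where "c' i = sgn (b i) * c (inv p i)" for i
  have c': "c' \<in> E" "N c' \<le> N c"
    by (rule solid[OF c permutes_bij[OF permutes_inv[OF p]]],
        simp add: c'_def abs_mult abs_sgn_eq)+
  have "(\<Sum>i<n. \<bar>b (p i)\<bar> * c i) = (\<Sum>i<n. \<bar>b (p i)\<bar> * c (inv p (p i)))"
    by (simp add: permutes_inverses[OF p])
  also have "\<dots> = (\<Sum>i<n. \<bar>b i\<bar> * c (inv p i))"
    using sum.permute[OF p, of "\<lambda>i. \<bar>b i\<bar> * c (inv p i)"] by (simp add: o_def)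
  also have "\<dots> = (\<Sum>i<n. b i * c' i)"
    by (simp add: c'_def abs_sgn mult.assoc)
  also have "\<dots> \<le> N c" using b c' unfolding dual_on_def by force
  finally show "(\<Sum>i<n. \<bar>b (p i)\<bar> * c i) \<le> N c" .
qed

text \<open>
  Norming functionals bound the norms of the truncations of \<open>s\<close>. The truncations increase to
  \<open>s\<close>, and the Fatou property transfers membership and the bound to the limit.
\<close>

lemma mem_if_dual_bounded:
  assumes s: "\<And>n. 0 \<le> s n" and bound: "\<And>n b. dual_on n b \<Longrightarrow> (\<Sum>i<n. b i * s i) \<le> M"
  shows "s \<in> E" "N s \<le> M"
proof -
  have le: "N (truncate n s) \<le> M" for n
  proof -
    obtain b where b: "dual_on n b" "N (truncate n s) \<le> (\<Sum>i<n. b i * s i)"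
      using norming_functional by blast
    show ?thesis using b(2) bound[OF b(1)] by linarith
  qed
  have bdd: "bdd_above (range (\<lambda>k. N (truncate k s)))" using le by (intro bdd_aboveI2)
  have "\<exists>b\<in>E. (\<forall>n. (\<lambda>k. truncate k s n) \<longlonglongrightarrow> b n) \<and> N b = (SUP k. N (truncate k s))"
    by (rule fatou[unfolded fatou_property_def, rule_format])
      (use truncate_mem bdd s in \<open>auto simp: truncate_def\<close>)
  then obtain b where b: "b \<in> E" "\<And>n. (\<lambda>k. truncate k s n) \<longlonglongrightarrow> b n"
      "N b = (SUP k. N (truncate k s))" by blast
  have "b n = s n" for n
  proof (rule LIMSEQ_unique[OF b(2)])
    show "(\<lambda>k. truncate k s n) \<longlonglongrightarrow> s n"
      by (intro tendsto_eventually eventually_mono[OF eventually_gt_at_top[of n]]) (simp add: truncate_def)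
  qed
  then have "b = s" by blast
  then show "s \<in> E" "N s \<le> M" using b le by (auto intro: cSUP_least)
qed

text \<open>
  After sorting the absolute values of \<open>b\<close>, summation by parts reduces the estimate to sums of
  initial segments; the sorting permutes \<open>z\<close> as well, hence the condition on all permutations.
\<close>

lemma dual_on_sum_le:
  fixes z :: "nat \<Rightarrow> complex"
  assumes b: "dual_on n b" and s: "s \<in> E"
    and le: "\<And>p m. p permutes {..<n} \<Longrightarrow> m \<le> n \<Longrightarrow> (\<Sum>i<m. norm (z (p i))) \<le> (\<Sum>i<m. s i)"
  shows "norm (\<Sum>i<n. complex_of_real (b i) * z i) \<le> N s"
proof -
  obtain p where p: "p permutes {..<n}" "\<And>i j. i \<le> j \<Longrightarrow> j < n \<Longrightarrow> \<bar>b (p j)\<bar> \<le> \<bar>b (p i)\<bar>"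
    using exists_sorting_permutation[of n "\<lambda>i. \<bar>b i\<bar>"] by blast
  have "norm (\<Sum>i<n. complex_of_real (b i) * z i) \<le> (\<Sum>i<n. \<bar>b i\<bar> * norm (z i))"
    by (rule sum_norm_le) (simp add: norm_mult)
  also have "\<dots> = (\<Sum>i<n. \<bar>b (p i)\<bar> * norm (z (p i)))"
    using sum.permute[OF p(1), of "\<lambda>i. \<bar>b i\<bar> * norm (z i)"] by (simp add: o_def)
  also have "\<dots> \<le> (\<Sum>i<n. \<bar>b (p i)\<bar> * s i)"
    by (rule sum_mult_decreasing_mono) (use p le in auto)
  also have "\<dots> \<le> N s"
    using dual_on_permute[OF b p(1)] s by (simp add: dual_on_def)
  finally show ?thesis .
qed

end


section \<open>The ideal norm as a supremum of pairings\<close>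

text \<open>
  With weights in \<open>[0, 1]\<close> of total mass at most \<open>m\<close>, a decreasing sequence gives the largest
  sum when all the mass sits on its first \<open>m\<close> terms.
\<close>

lemma weighted_sum_le_initial_sum:
  fixes s w :: "nat \<Rightarrow> real"
  assumes dec: "decseq s" and s0: "0 \<le> s m" and w: "\<And>k. 0 \<le> w k" "\<And>k. w k \<le> 1"
    and total: "(\<Sum>k<n. w k) \<le> real m" and "m \<le> n"
  shows "(\<Sum>k<n. s k * w k) \<le> (\<Sum>k<m. s k)"
proof -
  have "(\<Sum>k<n. s k * w k) = (\<Sum>k<n. (s k - s m) * w k) + s m * (\<Sum>k<n. w k)"
    by (simp add: algebra_simps sum_distrib_left sum_subtractf)
  also have "(\<Sum>k<n. (s k - s m) * w k) \<le> (\<Sum>k<n. if k < m then s k - s m else 0)"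
  proof (rule sum_mono)
    fix k
    show "(s k - s m) * w k \<le> (if k < m then s k - s m else 0)"
      using w[of k] decseqD[OF dec, of k m] decseqD[OF dec, of m k]
      by (auto simp: mult_left_le mult_nonpos_nonneg)
  qed
  also have "(\<Sum>k<n. if k < m then s k - s m else 0) = (\<Sum>k<m. s k - s m)"
    using \<open>m \<le> n\<close> by (intro sum.mono_neutral_cong_right) auto
  also have "s m * (\<Sum>k<n. w k) \<le> s m * real m"
    using total s0 by (rule mult_left_mono)
  finally show ?thesis by (simp add: sum_subtractf algebra_simps)
qed

text \<open>
  Inserting the Schmidt expansion of \<open>x\<close> turns the left hand side into a weighted sum of the
  singular values. Bessel's inequality in the index \<open>i\<close> bounds each weight by \<open>1\<close>, and in the
  index \<open>k\<close> bounds the total mass by \<open>m\<close>.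
\<close>

lemma ky_fan:
  assumes x: "schmidt x s e f"
    and e': "orthonormal_on {..<m} e'" and f': "orthonormal_on {..<m} f'"
  shows "(\<Sum>i<m. norm (cinner (x (f' i)) (e' i))) \<le> (\<Sum>k<m. s k)"
proof -
  note e = schmidt_orthonormal(1)[OF x] and f = schmidt_orthonormal(2)[OF x]
  define w where "w k = (\<Sum>i<m. norm (cinner (f k) (f' i)) * norm (cinner (e k) (e' i)))" for k
  have w0: "0 \<le> w k" for k by (simp add: w_def sum_nonneg)
  have w1: "w k \<le> 1" for k
    using bessel_product[OF f' e', of "f k" "e k"] orthonormal_on_norm[OF e, of k]
      orthonormal_on_norm[OF f, of k] by (simp add: w_def)
  have total: "(\<Sum>k<n. w k) \<le> real m" for n
  proof -
    have "(\<Sum>k<n. norm (cinner (f k) (f' i)) * norm (cinner (e k) (e' i))) \<le> 1" if "i < m" for i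
      using bessel_product[OF orthonormal_on_subset[OF f] orthonormal_on_subset[OF e], of "{..<n}" "f' i" "e' i"]
        orthonormal_on_norm[OF e', of i] orthonormal_on_norm[OF f', of i] that
      by (simp add: norm_cinner_commute[of "f' i"] norm_cinner_commute[of "e' i"])
    then have "(\<Sum>i<m. \<Sum>k<n. norm (cinner (f k) (f' i)) * norm (cinner (e k) (e' i))) \<le> (\<Sum>i<m. 1)"
      by (intro sum_mono) simp
    then show ?thesis by (subst (asm) sum.swap) (simp add: w_def)
  qed
  have bound: "(\<Sum>i<m. norm (cinner (x (f' i)) (e' i))) \<le> (\<Sum>k<m. s k) + real m * s n" if "m \<le> n" for n
  proof -
    have "norm (cinner (x (f' i)) (e' i))
        \<le> (\<Sum>k<n. s k * (norm (cinner (f k) (f' i)) * norm (cinner (e k) (e' i)))) + s n" if "i < m" for i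
    proof -
      define S where "S = (\<Sum>k<n. (complex_of_real (s k) * cinner (f' i) (f k)) *\<^sub>C e k)"
      have "norm (cinner (x (f' i) - S) (e' i)) \<le> s n"
        using norm_cinner_le[of "x (f' i) - S" "e' i"] schmidt_remainder[OF x, of "f' i" n]
          orthonormal_on_norm[OF e', of i] orthonormal_on_norm[OF f', of i] that
        by (simp add: S_def)
      moreover have "norm (cinner S (e' i)) \<le> (\<Sum>k<n. s k * (norm (cinner (f k) (f' i)) * norm (cinner (e k) (e' i))))"
        unfolding S_def cinner_sum_left
        by (rule sum_norm_le)
          (simp add: cinner_scaleC_left norm_mult schmidt_nonneg[OF x] norm_cinner_commute[of "f' i"])
      moreover have "cinner (x (f' i)) (e' i) = cinner S (e' i) + cinner (x (f' i) - S) (e' i)"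
        by (simp add: cinner_diff_left)
      ultimately show ?thesis
        using norm_triangle_ineq[of "cinner S (e' i)" "cinner (x (f' i) - S) (e' i)"] by simp
    qed
    then have "(\<Sum>i<m. norm (cinner (x (f' i)) (e' i)))
        \<le> (\<Sum>i<m. (\<Sum>k<n. s k * (norm (cinner (f k) (f' i)) * norm (cinner (e k) (e' i)))) + s n)"
      by (intro sum_mono) simp
    also have "\<dots> = (\<Sum>k<n. s k * w k) + real m * s n"
      unfolding sum.distrib by (subst sum.swap) (simp add: w_def sum_distrib_left)
    also have "(\<Sum>k<n. s k * w k) \<le> (\<Sum>k<m. s k)"
      by (rule weighted_sum_le_initial_sum[OF schmidt_decseq[OF x] schmidt_nonneg[OF x] w0 w1 total \<open>m \<le> n\<close>])
    finally show ?thesis by simp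
  qed
  have "(\<lambda>n. (\<Sum>k<m. s k) + real m * s n) \<longlonglongrightarrow> (\<Sum>k<m. s k) + real m * 0"
    by (intro tendsto_intros schmidt_tendsto_0[OF x])
  then have "(\<lambda>n. (\<Sum>k<m. s k) + real m * s n) \<longlonglongrightarrow> (\<Sum>k<m. s k)" by simp
  then show ?thesis
    by (rule tendsto_lowerbound) (simp_all add: bound eventually_mono[OF eventually_ge_at_top[of m]])
qed

lemma orthonormal_on_permute:
  assumes "orthonormal_on {..<n} e" "p permutes {..<n}" "m \<le> n"
  shows "orthonormal_on {..<m} (\<lambda>i. e (p i))"
  unfolding orthonormal_on_def
proof (intro ballI)
  fix i j assume "i \<in> {..<m}" "j \<in> {..<m}"
  then have "p i \<in> {..<n}" "p j \<in> {..<n}"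
    using assms(2,3) by (simp_all add: permutes_in_image del: lessThan_iff) auto
  moreover have "p i = p j \<longleftrightarrow> i = j" using permutes_inj[OF assms(2)] by (auto dest: injD)
  ultimately show "cinner (e (p i)) (e (p j)) = (if i = j then 1 else 0)"
    using orthonormal_onD[OF assms(1)] by simp
qed

lemma compact_clinear_add:
  assumes x: "compact_clinear x" and y: "compact_clinear y"
  shows "compact_clinear (\<lambda>u. x u + y u)"
proof (rule compact_clinearI)
  have lin: "clinear x" "clinear y" using x y by (simp_all add: compact_clinear_def)
  show "clinear (\<lambda>u. x u + y u)"
    by (rule clinearI) (simp_all add: clinear_add[OF lin(1)] clinear_add[OF lin(2)]
        clinear_scaleC[OF lin(1)] clinear_scaleC[OF lin(2)] scaleC_add_right)
  show "compact {a + b |a b. a \<in> closure (x ` cball 0 1) \<and> b \<in> closure (y ` cball 0 1)}"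
    using x y by (intro compact_sums) (simp_all add: compact_clinear_def)
  show "(\<lambda>u. x u + y u) ` cball 0 1
      \<subseteq> {a + b |a b. a \<in> closure (x ` cball 0 1) \<and> b \<in> closure (y ` cball 0 1)}"
    using closure_subset[of "x ` cball 0 1"] closure_subset[of "y ` cball 0 1"] by blast
qed

lemma compact_clinear_compose:
  assumes x: "compact_clinear x" and v: "clinear v" "bounded_linear v"
  shows "compact_clinear (\<lambda>u. v (x u))"
proof (rule compact_clinearI)
  have lin: "clinear x" using x by (simp add: compact_clinear_def)
  show "clinear (\<lambda>u. v (x u))"
    by (rule clinearI) (simp_all add: clinear_add[OF lin] clinear_add[OF v(1)]
        clinear_scaleC[OF lin] clinear_scaleC[OF v(1)])
  show "compact (v ` closure (x ` cball 0 1))"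
    using x v(2) by (intro compact_continuous_image linear_continuous_on) (simp_all add: compact_clinear_def)
  show "(\<lambda>u. v (x u)) ` cball 0 1 \<subseteq> v ` closure (x ` cball 0 1)"
    using closure_subset[of "x ` cball 0 1"] by blast
qed

definition rank_one :: "'a::complex_hilbert \<Rightarrow> 'a \<Rightarrow> 'a \<Rightarrow> 'a"
  where "rank_one a b = (\<lambda>u. cinner u b *\<^sub>C a)"

text \<open>
  The image of the unit ball lies in a disc of the complex line through \<open>a\<close>.
\<close>

lemma compact_clinear_rank_one: "compact_clinear (rank_one a b)"
proof (rule compact_clinearI)
  show "clinear (rank_one a b)"
    by (rule clinearI) (simp_all add: rank_one_def cinner_simps scaleC_add_left scaleC_scaleC)
  have "bounded_linear (\<lambda>c::complex. c *\<^sub>C a)"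
  proof (rule bounded_linear_intro)
    show "(r *\<^sub>R c) *\<^sub>C a = r *\<^sub>R (c *\<^sub>C a)" for r and c :: complex
      unfolding scaleC_of_real[symmetric] scaleC_scaleC by (simp add: scaleC_complex_def)
    show "norm (c *\<^sub>C a) \<le> norm c * norm a" for c :: complex by (simp add: norm_scaleC)
  qed (rule scaleC_add_left)
  then show "compact ((\<lambda>c::complex. c *\<^sub>C a) ` cball 0 (norm b))"
    by (intro compact_continuous_image linear_continuous_on compact_cball)
  show "rank_one a b ` cball 0 1 \<subseteq> (\<lambda>c. c *\<^sub>C a) ` cball 0 (norm b)"
  proof
    fix w assume "w \<in> rank_one a b ` cball 0 1"
    then obtain u where u: "norm u \<le> 1" "w = cinner u b *\<^sub>C a" by (auto simp: rank_one_def)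
    have "norm (cinner u b) \<le> norm b"
      using norm_cinner_le[of u b] mult_right_mono[OF u(1), of "norm b"] by simp
    then show "w \<in> (\<lambda>c. c *\<^sub>C a) ` cball 0 (norm b)" using u(2) by (intro image_eqI[of _ _ "cinner u b"]) simp_all
  qed
qed

text \<open>
  For a unit vector \<open>a\<close>: the identity on the complex line through \<open>a\<close> and \<open>-1\<close> on its
  orthogonal complement.
\<close>

definition reflection :: "'a::complex_hilbert \<Rightarrow> 'a \<Rightarrow> 'a"
  where "reflection a w = (2 * cinner w a) *\<^sub>C a - w"

lemma reflection_symmetric: "cinner (reflection a v) w = cinner v (reflection a w)"
  using cinner_commute[of w a] by (simp add: reflection_def cinner_simps)

lemma reflection_involution: "norm a = 1 \<Longrightarrow> reflection a (reflection a w) = w"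
  by (simp add: reflection_def cinner_simps cinner_self algebra_simps flip: scaleC_add_left scaleC_minus1)

lemma clinear_reflection: "clinear (reflection a)"
  by (rule clinearI) (simp_all add: reflection_def cinner_simps algebra_simps scaleC_add_left
      complex_vector.scale_right_diff_distrib scaleC_scaleC)

lemma bounded_linear_reflection:
  assumes "norm a = 1"
  shows "bounded_linear (reflection a)"
proof (rule clinear_bounded_linear[OF clinear_reflection])
  fix w
  have "cinner (reflection a w) (reflection a w) = cinner w w"
    by (simp add: reflection_symmetric reflection_involution[OF assms])
  then show "norm (reflection a w) \<le> 1 * norm w" by (simp add: norm_eq_sqrt_cinner)
qed

locale fatou_ideal = infinite_dimensional_hilbert hilbert + fatou_sequence_space E N
  for hilbert :: "'h::complex_hilbert itself" and E N
begin

abbreviation X :: "('h \<Rightarrow> 'h) set"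
  where "X \<equiv> symmetric_ideal E"

abbreviation \<nu> :: "('h \<Rightarrow> 'h) \<Rightarrow> real"
  where "\<nu> \<equiv> symmetric_ideal_norm N"

text \<open>
  In contrast to the singular values, these pairings are linear in \<open>x\<close>. By the next two lemmas
  they compute the norm, which makes its triangle inequality and its invariance under
  unitaries visible.
\<close>

definition pairing_bound :: "('h \<Rightarrow> 'h) \<Rightarrow> real \<Rightarrow> bool"
  where "pairing_bound x M \<longleftrightarrow> (\<forall>n b e f. dual_on n b \<longrightarrow> orthonormal_on {..<n} e \<longrightarrow>
    orthonormal_on {..<n} f \<longrightarrow> norm (\<Sum>i<n. complex_of_real (b i) * cinner (x (f i)) (e i)) \<le> M)"

lemma pairing_boundD:
  "pairing_bound x M \<Longrightarrow> dual_on n b \<Longrightarrow> orthonormal_on {..<n} e \<Longrightarrow> orthonormal_on {..<n} f \<Longrightarrow>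
    norm (\<Sum>i<n. complex_of_real (b i) * cinner (x (f i)) (e i)) \<le> M"
  by (simp add: pairing_bound_def)

lemma ideal_compact: "x \<in> X \<Longrightarrow> compact_clinear x"
  by (simp add: symmetric_ideal_def)

text \<open>
  Ky Fan's inequality is exactly the condition that lets the dual functional \<open>b\<close> be evaluated
  at the singular values.
\<close>

lemma ideal_pairing_bound:
  assumes x: "x \<in> X"
  shows "pairing_bound x (\<nu> x)"
  unfolding pairing_bound_def
proof (intro allI impI)
  fix n b and e f :: "nat \<Rightarrow> 'h"
  assume b: "dual_on n b" and e: "orthonormal_on {..<n} e" and f: "orthonormal_on {..<n} f"
  obtain s e' f' where sch: "schmidt x s e' f'"
    using schmidt_decomposition[OF ideal_compact[OF x]] by blast
  note sv = schmidt_singular_values[OF sch]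
  have "norm (\<Sum>i<n. complex_of_real (b i) * cinner (x (f i)) (e i)) \<le> N s"
  proof (rule dual_on_sum_le[OF b])
    show "s \<in> E" using x sv by (simp add: symmetric_ideal_def)
    show "(\<Sum>i<m. norm (cinner (x (f (p i))) (e (p i)))) \<le> (\<Sum>i<m. s i)" if "p permutes {..<n}" "m \<le> n" for p m
      by (rule ky_fan[OF sch orthonormal_on_permute[OF e that] orthonormal_on_permute[OF f that]])
  qed
  then show "norm (\<Sum>i<n. complex_of_real (b i) * cinner (x (f i)) (e i)) \<le> \<nu> x"
    by (simp add: symmetric_ideal_norm_def sv)
qed

text \<open>
  On the singular vectors of \<open>x\<close> the pairing is \<open>(\<Sum>i<n. b i * s i)\<close>.
\<close>

lemma ideal_if_pairing_bound:
  assumes x: "compact_clinear x" and bound: "pairing_bound x M"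
  shows "x \<in> X" "\<nu> x \<le> M"
proof -
  obtain s e f where sch: "schmidt x s e f" using schmidt_decomposition[OF x] by blast
  note e = schmidt_orthonormal(1)[OF sch] and f = schmidt_orthonormal(2)[OF sch]
  have "(\<Sum>i<n. b i * s i) \<le> M" if b: "dual_on n b" for n b
  proof -
    have "(\<Sum>i<n. complex_of_real (b i) * cinner (x (f i)) (e i)) = complex_of_real (\<Sum>i<n. b i * s i)"
      using orthonormal_onD[OF e] by (simp add: schmidt_apply[OF sch] cinner_scaleC_left)
    moreover have "norm (\<Sum>i<n. complex_of_real (b i) * cinner (x (f i)) (e i)) \<le> M"
      by (rule pairing_boundD[OF bound b]) (use e f orthonormal_on_subset in blast)+
    ultimately show ?thesis by (simp only: norm_of_real)
  qed
  from mem_if_dual_bounded[OF schmidt_nonneg[OF sch] this]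
  show "x \<in> X" "\<nu> x \<le> M"
    using x by (simp_all add: symmetric_ideal_def symmetric_ideal_norm_def schmidt_singular_values[OF sch])
qed

lemma ideal_add:
  assumes x: "x \<in> X" and y: "y \<in> X"
  shows "(\<lambda>u. x u + y u) \<in> X" "\<nu> (\<lambda>u. x u + y u) \<le> \<nu> x + \<nu> y"
proof -
  have "pairing_bound (\<lambda>u. x u + y u) (\<nu> x + \<nu> y)"
    unfolding pairing_bound_def
  proof (intro allI impI)
    fix n b and e f :: "nat \<Rightarrow> 'h"
    assume bef: "dual_on n b" "orthonormal_on {..<n} e" "orthonormal_on {..<n} f"
    show "norm (\<Sum>i<n. complex_of_real (b i) * cinner (x (f i) + y (f i)) (e i)) \<le> \<nu> x + \<nu> y"
      unfolding cinner_add_left distrib_left sum.distrib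
      by (rule norm_triangle_mono[OF pairing_boundD[OF ideal_pairing_bound[OF x] bef]
            pairing_boundD[OF ideal_pairing_bound[OF y] bef]])
  qed
  from ideal_if_pairing_bound[OF compact_clinear_add[OF ideal_compact[OF x] ideal_compact[OF y]] this]
  show "(\<lambda>u. x u + y u) \<in> X" "\<nu> (\<lambda>u. x u + y u) \<le> \<nu> x + \<nu> y" .
qed

lemma ideal_scaleC:
  assumes x: "x \<in> X"
  shows "(\<lambda>u. c *\<^sub>C x u) \<in> X" "\<nu> (\<lambda>u. c *\<^sub>C x u) \<le> norm c * \<nu> x"
proof -
  have "pairing_bound (\<lambda>u. c *\<^sub>C x u) (norm c * \<nu> x)"
    unfolding pairing_bound_def
  proof (intro allI impI)
    fix n b and e f :: "nat \<Rightarrow> 'h"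
    assume bef: "dual_on n b" "orthonormal_on {..<n} e" "orthonormal_on {..<n} f"
    have "(\<Sum>i<n. complex_of_real (b i) * cinner (c *\<^sub>C x (f i)) (e i))
        = c * (\<Sum>i<n. complex_of_real (b i) * cinner (x (f i)) (e i))"
      by (simp add: cinner_scaleC_left sum_distrib_left mult.left_commute)
    then show "norm (\<Sum>i<n. complex_of_real (b i) * cinner (c *\<^sub>C x (f i)) (e i)) \<le> norm c * \<nu> x"
      using pairing_boundD[OF ideal_pairing_bound[OF x] bef] by (simp add: norm_mult mult_left_mono)
  qed
  from ideal_if_pairing_bound[OF compact_clinear_compose[OF ideal_compact[OF x]
        clinearI[OF scaleC_add_right complex_vector.scale_left_commute] bounded_linear_scaleC] this]
  show "(\<lambda>u. c *\<^sub>C x u) \<in> X" "\<nu> (\<lambda>u. c *\<^sub>C x u) \<le> norm c * \<nu> x" .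
qed

text \<open>
  The reflection moves to the frame \<open>e\<close>, which stays orthonormal.
\<close>

lemma ideal_reflection:
  assumes x: "x \<in> X" and a: "norm a = 1"
  shows "\<nu> (\<lambda>u. reflection a (x u)) \<le> \<nu> x"
proof -
  have "pairing_bound (\<lambda>u. reflection a (x u)) (\<nu> x)"
    unfolding pairing_bound_def
  proof (intro allI impI)
    fix n b and e f :: "nat \<Rightarrow> 'h"
    assume b: "dual_on n b" and e: "orthonormal_on {..<n} e" and f: "orthonormal_on {..<n} f"
    have "orthonormal_on {..<n} (\<lambda>i. reflection a (e i))"
      using e by (simp add: orthonormal_on_def reflection_symmetric reflection_involution[OF a])
    from pairing_boundD[OF ideal_pairing_bound[OF x] b this f]
    show "norm (\<Sum>i<n. complex_of_real (b i) * cinner (reflection a (x (f i))) (e i)) \<le> \<nu> x"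
      by (simp add: reflection_symmetric)
  qed
  from ideal_if_pairing_bound(2)[OF compact_clinear_compose[OF ideal_compact[OF x]
        clinear_reflection bounded_linear_reflection[OF a]] this]
  show ?thesis .
qed

lemma dual_on_abs_le_1:
  assumes b: "dual_on n b" and "i < n"
  shows "\<bar>b i\<bar> \<le> 1"
proof -
  have "(\<Sum>j<n. b j * (sgn (b i) * unit_seq i j)) \<le> N (\<lambda>j. sgn (b i) * unit_seq i j)"
    by (rule bspec[OF b[unfolded dual_on_def] scale_mem[OF unit_seq_mem]])
  also have "\<dots> \<le> 1" by (simp add: norm_scale[OF unit_seq_mem] norm_unit_seq abs_sgn_eq)
  also have "(\<Sum>j<n. b j * (sgn (b i) * unit_seq i j)) = (\<Sum>j<n. if j = i then \<bar>b i\<bar> else 0)"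
    by (rule sum.cong) (auto simp: unit_seq_def abs_sgn)
  finally show ?thesis using \<open>i < n\<close> by simp
qed

text \<open>
  The coefficients \<open>b i\<close> are at most \<open>1\<close> in absolute value, so the Cauchy--Schwarz and Bessel
  inequalities apply.
\<close>

lemma ideal_rank_one: "rank_one a c \<in> X" "\<nu> (rank_one a c) \<le> norm a * norm c"
proof -
  have "pairing_bound (rank_one a c) (norm a * norm c)"
    unfolding pairing_bound_def
  proof (intro allI impI)
    fix n b and e f :: "nat \<Rightarrow> 'h"
    assume b: "dual_on n b" and e: "orthonormal_on {..<n} e" and f: "orthonormal_on {..<n} f"
    have L2: "L2_set (\<lambda>i. norm (cinner u (g i))) {..<n} \<le> norm u" if "orthonormal_on {..<n} g" for u g
      unfolding L2_set_def using bessel[OF that, of u] by (intro real_le_lsqrt) (auto intro: sum_nonneg)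
    have "norm (\<Sum>i<n. complex_of_real (b i) * cinner (rank_one a c (f i)) (e i))
        \<le> (\<Sum>i<n. norm (cinner a (e i)) * norm (cinner c (f i)))"
    proof (rule sum_norm_le)
      fix i assume "i \<in> {..<n}"
      then show "norm (complex_of_real (b i) * cinner (rank_one a c (f i)) (e i))
          \<le> norm (cinner a (e i)) * norm (cinner c (f i))"
        using mult_right_mono[OF dual_on_abs_le_1[OF b], of i "norm (cinner a (e i)) * norm (cinner c (f i))"]
        by (simp add: rank_one_def cinner_scaleC_left norm_mult norm_cinner_commute[of c] mult.commute)
    qed
    also have "\<dots> \<le> L2_set (\<lambda>i. norm (cinner a (e i))) {..<n} * L2_set (\<lambda>i. norm (cinner c (f i))) {..<n}"
      using L2_set_mult_ineq[of "\<lambda>i. norm (cinner a (e i))" "\<lambda>i. norm (cinner c (f i))" "{..<n}"] by simp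
    also have "\<dots> \<le> norm a * norm c"
      by (intro mult_mono L2 e f L2_set_nonneg) simp
    finally show "norm (\<Sum>i<n. complex_of_real (b i) * cinner (rank_one a c (f i)) (e i)) \<le> norm a * norm c" .
  qed
  from ideal_if_pairing_bound[OF compact_clinear_rank_one this]
  show "rank_one a c \<in> X" "\<nu> (rank_one a c) \<le> norm a * norm c" .
qed

text \<open>
  Coordinate functionals have norm \<open>1\<close> on \<open>E\<close>.
\<close>

lemma cinner_le_ideal_norm:
  assumes x: "x \<in> X" and "norm \<xi> = 1" "norm \<eta> = 1"
  shows "norm (cinner (x \<eta>) \<xi>) \<le> \<nu> x"
proof -
  have "dual_on 1 (\<lambda>_. 1)"
    unfolding dual_on_def
  proof
    fix c assume c: "c \<in> E"
    have "truncate 1 c = (\<lambda>k. c 0 * unit_seq 0 k)" by (auto simp: truncate_def unit_seq_def)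
    then have "\<bar>c 0\<bar> \<le> N c"
      using norm_truncate_le[OF c, of 1] by (simp add: norm_scale[OF unit_seq_mem] norm_unit_seq)
    then show "(\<Sum>i<1. 1 * c i) \<le> N c" by simp
  qed
  from pairing_boundD[OF ideal_pairing_bound[OF x] this, of "\<lambda>_. \<xi>" "\<lambda>_. \<eta>"] assms
  show ?thesis by (simp add: orthonormal_on_def cinner_self)
qed

end


section \<open>Slopes of the ideal norm along a rank one operator\<close>

context fatou_ideal
begin

text \<open>
  The slope is the one-sided derivative at \<open>y\<close> of the norm in the direction \<open>x\<close>, written as the
  limit of \<open>norm (x + n y) - norm (n y)\<close> for large \<open>n\<close>, where \<open>y\<close> is meant to have norm \<open>1\<close>. Integral \<open>n\<close>
  suffice because the difference is monotone.
\<close>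

definition excess :: "('h \<Rightarrow> 'h) \<Rightarrow> ('h \<Rightarrow> 'h) \<Rightarrow> nat \<Rightarrow> real"
  where "excess y x n = \<nu> (\<lambda>u. x u + complex_of_real (real n) *\<^sub>C y u) - real n"

definition slope :: "('h \<Rightarrow> 'h) \<Rightarrow> ('h \<Rightarrow> 'h) \<Rightarrow> real"
  where "slope y x = lim (excess y x)"

text \<open>
  The excess decreases by the triangle inequality and is bounded below because the coefficient
  of \<open>x + n y\<close> at \<open>\<eta>\<close> and \<open>\<xi>\<close> grows like \<open>n\<close>.
\<close>

lemma excess_tendsto_slope:
  assumes \<xi>: "norm \<xi> = 1" and \<eta>: "norm \<eta> = 1" and x: "x \<in> X"
  shows "excess (rank_one \<xi> \<eta>) x \<longlonglongrightarrow> slope (rank_one \<xi> \<eta>) x"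
proof -
  define y where "y = rank_one \<xi> \<eta>"
  have y: "y \<in> X" "\<nu> y \<le> 1" using ideal_rank_one[of \<xi> \<eta>] \<xi> \<eta> by (simp_all add: y_def)
  have mem: "(\<lambda>u. x u + c *\<^sub>C y u) \<in> X" for c by (intro ideal_add ideal_scaleC x y)
  have "decseq (excess y x)"
  proof (rule decseq_SucI)
    fix n
    have "(\<lambda>u. x u + complex_of_real (real (Suc n)) *\<^sub>C y u)
        = (\<lambda>u. (x u + complex_of_real (real n) *\<^sub>C y u) + y u)"
      by (simp add: scaleC_add_left add_ac)
    then show "excess y x (Suc n) \<le> excess y x n"
      using ideal_add(2)[OF mem[of "complex_of_real (real n)"] y(1)] y(2) by (simp add: excess_def)
  qed
  moreover have "- norm (cinner (x \<eta>) \<xi>) \<le> excess y x n" for n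
  proof -
    have "cinner (x \<eta> + complex_of_real (real n) *\<^sub>C y \<eta>) \<xi> = complex_of_real (real n) + cinner (x \<eta>) \<xi>"
      by (simp add: y_def rank_one_def cinner_simps cinner_self_eq_1[OF \<xi>] cinner_self_eq_1[OF \<eta>])
    with cinner_le_ideal_norm[OF mem \<xi> \<eta>, of "complex_of_real (real n)"]
    have "norm (complex_of_real (real n) + cinner (x \<eta>) \<xi>) \<le> \<nu> (\<lambda>u. x u + complex_of_real (real n) *\<^sub>C y u)"
      by simp
    moreover have "real n - norm (cinner (x \<eta>) \<xi>) \<le> norm (complex_of_real (real n) + cinner (x \<eta>) \<xi>)"
      using norm_diff_ineq[of "complex_of_real (real n)" "cinner (x \<eta>) \<xi>"] by simp
    ultimately show ?thesis by (simp add: excess_def)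
  qed
  ultimately obtain L where "excess y x \<longlonglongrightarrow> L" using decseq_convergent by metis
  then show ?thesis unfolding slope_def y_def by (simp add: limI)
qed

text \<open>
  Split \<open>2 n y\<close> evenly between the two summands.
\<close>

lemma slope_add_le:
  assumes \<xi>: "norm \<xi> = 1" and \<eta>: "norm \<eta> = 1" and x: "x \<in> X" and x': "x' \<in> X"
  shows "slope (rank_one \<xi> \<eta>) (\<lambda>u. x u + x' u) \<le> slope (rank_one \<xi> \<eta>) x + slope (rank_one \<xi> \<eta>) x'"
proof -
  define y where "y = rank_one \<xi> \<eta>"
  have mem: "(\<lambda>u. z u + c *\<^sub>C y u) \<in> X" if "z \<in> X" for c z
    unfolding y_def by (intro ideal_add ideal_scaleC that ideal_rank_one)
  note lim = excess_tendsto_slope[OF \<xi> \<eta>, folded y_def]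
  have "excess y (\<lambda>u. x u + x' u) (2 * n) \<le> excess y x n + excess y x' n" for n
  proof -
    have "(\<lambda>u. (x u + x' u) + complex_of_real (real (2 * n)) *\<^sub>C y u)
        = (\<lambda>u. (x u + complex_of_real (real n) *\<^sub>C y u) + (x' u + complex_of_real (real n) *\<^sub>C y u))"
    proof
      have "complex_of_real (real (2 * n)) = complex_of_real (real n) + complex_of_real (real n)" by simp
      then show "(x u + x' u) + complex_of_real (real (2 * n)) *\<^sub>C y u
          = (x u + complex_of_real (real n) *\<^sub>C y u) + (x' u + complex_of_real (real n) *\<^sub>C y u)" for u
        by (simp only: scaleC_add_left) (simp add: algebra_simps)
    qed
    then show ?thesis
      using ideal_add(2)[OF mem[OF x, of "complex_of_real (real n)"] mem[OF x', of "complex_of_real (real n)"]]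
      by (simp add: excess_def)
  qed
  moreover have "(\<lambda>n. excess y (\<lambda>u. x u + x' u) (2 * n)) \<longlonglongrightarrow> slope y (\<lambda>u. x u + x' u)"
    using LIMSEQ_subseq_LIMSEQ[OF lim[OF ideal_add(1)[OF x x']], of "\<lambda>n. 2 * n"]
    by (simp add: strict_mono_def o_def)
  ultimately have "slope y (\<lambda>u. x u + x' u) \<le> slope y x + slope y x'"
    by (intro LIMSEQ_le[OF _ tendsto_add[OF lim[OF x] lim[OF x']]]) auto
  then show ?thesis by (simp add: y_def)
qed

text \<open>
  The square root of \<open>(n + p)\<^sup>2 + q\<close> is at most \<open>n + p + q / (2 * (n + p))\<close>, so \<open>q\<close> does not
  contribute to the limit.
\<close>

lemma slope_le:
  assumes \<xi>: "norm \<xi> = 1" and \<eta>: "norm \<eta> = 1" and x: "x \<in> X"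
    and le: "\<And>n. (\<nu> (\<lambda>u. x u + complex_of_real (real n) *\<^sub>C rank_one \<xi> \<eta> u))\<^sup>2 \<le> (real n + p)\<^sup>2 + q" and q: "0 \<le> q"
  shows "slope (rank_one \<xi> \<eta>) x \<le> p"
proof (rule tendsto_le[OF sequentially_bot _ excess_tendsto_slope[OF \<xi> \<eta> x]])
  have "filterlim (\<lambda>n. 2 * (real n + p)) at_top sequentially"
    using filterlim_tendsto_pos_mult_at_top[OF tendsto_const[of 2] _
        filterlim_tendsto_add_at_top[OF tendsto_const[of p] filterlim_real_sequentially]]
    by (simp add: add.commute)
  then show "(\<lambda>n. p + q / (2 * (real n + p))) \<longlonglongrightarrow> p"
    using tendsto_add[OF tendsto_const[of p] tendsto_divide_0[OF tendsto_const[of q] filterlim_at_top_imp_at_infinity]]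
    by simp
  show "\<forall>\<^sub>F n in sequentially. excess (rank_one \<xi> \<eta>) x n \<le> p + q / (2 * (real n + p))"
    using eventually_gt_at_top[of "nat \<lceil>- p\<rceil>"]
  proof (rule eventually_mono)
    fix n assume "nat \<lceil>- p\<rceil> < n"
    then have "0 < real n + p" by linarith
    define r where "r = real n + p"
    have r: "0 < r" unfolding r_def by fact
    have "r\<^sup>2 + q \<le> (r + q / (2 * r))\<^sup>2"
      using r by (simp add: power2_sum)
    then have "(\<nu> (\<lambda>u. x u + complex_of_real (real n) *\<^sub>C rank_one \<xi> \<eta> u))\<^sup>2 \<le> (r + q / (2 * r))\<^sup>2"
      using le[of n] by (simp add: r_def)
    then have "\<nu> (\<lambda>u. x u + complex_of_real (real n) *\<^sub>C rank_one \<xi> \<eta> u) \<le> r + q / (2 * r)"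
    proof (rule power2_le_imp_le)
      show "0 \<le> r + q / (2 * r)" using r q by simp
    qed
    then show "excess (rank_one \<xi> \<eta>) x n \<le> p + q / (2 * (real n + p))"
      by (simp add: excess_def r_def)
  qed
qed

text \<open>
  A perturbation of \<open>\<xi>\<close> orthogonal to \<open>\<xi>\<close> is tangent to the sphere: it changes the norm only
  in second order. The next lemma is the same for \<open>\<eta>\<close>.
\<close>

lemma slope_rank_one_left_le:
  assumes \<xi>: "norm \<xi> = 1" and \<eta>: "norm \<eta> = 1" and a: "cinner a \<xi> = 0"
  shows "slope (rank_one \<xi> \<eta>) (rank_one a \<eta>) \<le> 0"
proof (rule slope_le[OF \<xi> \<eta> ideal_rank_one(1)])
  fix n
  have eq: "(\<lambda>u. rank_one a \<eta> u + complex_of_real (real n) *\<^sub>C rank_one \<xi> \<eta> u)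
      = rank_one (a + complex_of_real (real n) *\<^sub>C \<xi>) \<eta>"
    by (simp add: rank_one_def scaleC_add_right scaleC_scaleC mult.commute)
  have "(norm (a + complex_of_real (real n) *\<^sub>C \<xi>))\<^sup>2 = (real n)\<^sup>2 + (norm a)\<^sup>2"
    using pythagoras[of a "complex_of_real (real n) *\<^sub>C \<xi>"] a \<xi> by (simp add: cinner_scaleC_right norm_scaleC)
  moreover have "\<nu> (rank_one (a + complex_of_real (real n) *\<^sub>C \<xi>) \<eta>) \<le> norm (a + complex_of_real (real n) *\<^sub>C \<xi>)"
    using ideal_rank_one(2)[of "a + complex_of_real (real n) *\<^sub>C \<xi>" \<eta>] \<eta> by simp
  moreover have "0 \<le> \<nu> (rank_one (a + complex_of_real (real n) *\<^sub>C \<xi>) \<eta>)"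
    by (rule order_trans[OF norm_ge_zero cinner_le_ideal_norm[OF ideal_rank_one(1) \<xi> \<eta>]])
  ultimately show "(\<nu> (\<lambda>u. rank_one a \<eta> u + complex_of_real (real n) *\<^sub>C rank_one \<xi> \<eta> u))\<^sup>2
      \<le> (real n + 0)\<^sup>2 + (norm a)\<^sup>2"
    unfolding eq by (metis add.right_neutral power_mono)
qed simp

lemma slope_rank_one_right_le:
  assumes \<xi>: "norm \<xi> = 1" and \<eta>: "norm \<eta> = 1" and b: "cinner b \<eta> = 0"
  shows "slope (rank_one \<xi> \<eta>) (rank_one \<xi> b) \<le> 0"
proof (rule slope_le[OF \<xi> \<eta> ideal_rank_one(1)])
  fix n
  have eq: "(\<lambda>u. rank_one \<xi> b u + complex_of_real (real n) *\<^sub>C rank_one \<xi> \<eta> u)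
      = rank_one \<xi> (b + complex_of_real (real n) *\<^sub>C \<eta>)"
    by (simp add: rank_one_def cinner_simps scaleC_add_left scaleC_scaleC)
  have "(norm (b + complex_of_real (real n) *\<^sub>C \<eta>))\<^sup>2 = (real n)\<^sup>2 + (norm b)\<^sup>2"
    using pythagoras[of b "complex_of_real (real n) *\<^sub>C \<eta>"] b \<eta> by (simp add: cinner_scaleC_right norm_scaleC)
  moreover have "\<nu> (rank_one \<xi> (b + complex_of_real (real n) *\<^sub>C \<eta>)) \<le> norm (b + complex_of_real (real n) *\<^sub>C \<eta>)"
    using ideal_rank_one(2)[of \<xi> "b + complex_of_real (real n) *\<^sub>C \<eta>"] \<xi> by simp
  moreover have "0 \<le> \<nu> (rank_one \<xi> (b + complex_of_real (real n) *\<^sub>C \<eta>))"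
    by (rule order_trans[OF norm_ge_zero cinner_le_ideal_norm[OF ideal_rank_one(1) \<xi> \<eta>]])
  ultimately show "(\<nu> (\<lambda>u. rank_one \<xi> b u + complex_of_real (real n) *\<^sub>C rank_one \<xi> \<eta> u))\<^sup>2
      \<le> (real n + 0)\<^sup>2 + (norm b)\<^sup>2"
    unfolding eq by (metis add.right_neutral power_mono)
qed simp

lemma slope_multiple_le:
  assumes \<xi>: "norm \<xi> = 1" and \<eta>: "norm \<eta> = 1"
  shows "slope (rank_one \<xi> \<eta>) (\<lambda>u. c *\<^sub>C rank_one \<xi> \<eta> u) \<le> Re c"
proof (rule slope_le[OF \<xi> \<eta> ideal_scaleC(1)[OF ideal_rank_one(1)]])
  fix n
  have eq: "(\<lambda>u. c *\<^sub>C rank_one \<xi> \<eta> u + complex_of_real (real n) *\<^sub>C rank_one \<xi> \<eta> u)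
      = rank_one ((c + complex_of_real (real n)) *\<^sub>C \<xi>) \<eta>"
    by (simp add: rank_one_def scaleC_add_left scaleC_scaleC mult.commute algebra_simps)
  have "(norm (c + complex_of_real (real n)))\<^sup>2 = (real n + Re c)\<^sup>2 + (Im c)\<^sup>2"
    by (simp add: cmod_power2 add.commute)
  moreover have "\<nu> (rank_one ((c + complex_of_real (real n)) *\<^sub>C \<xi>) \<eta>) \<le> norm (c + complex_of_real (real n))"
    using ideal_rank_one(2)[of "(c + complex_of_real (real n)) *\<^sub>C \<xi>" \<eta>] \<xi> \<eta> by (simp add: norm_scaleC)
  moreover have "0 \<le> \<nu> (rank_one ((c + complex_of_real (real n)) *\<^sub>C \<xi>) \<eta>)"
    by (rule order_trans[OF norm_ge_zero cinner_le_ideal_norm[OF ideal_rank_one(1) \<xi> \<eta>]])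
  ultimately show "(\<nu> (\<lambda>u. c *\<^sub>C rank_one \<xi> \<eta> u + complex_of_real (real n) *\<^sub>C rank_one \<xi> \<eta> u))\<^sup>2
      \<le> (real n + Re c)\<^sup>2 + (Im c)\<^sup>2"
    unfolding eq by (metis power_mono)
qed simp

lemma slope_perturb_le:
  assumes \<xi>: "norm \<xi> = 1" and \<eta>: "norm \<eta> = 1" and d: "d \<in> X"
    and a: "cinner a \<xi> = 0" and b: "cinner b \<eta> = 0"
    and x: "\<And>u. x u = d u + c *\<^sub>C rank_one \<xi> \<eta> u + (rank_one a \<eta> u + rank_one \<xi> b u)"
  shows "x \<in> X" "slope (rank_one \<xi> \<eta>) x \<le> slope (rank_one \<xi> \<eta>) d + Re c"
proof -
  have x_eq: "x = (\<lambda>u. (d u + c *\<^sub>C rank_one \<xi> \<eta> u) + (rank_one a \<eta> u + rank_one \<xi> b u))"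
    using x by blast
  note mem = ideal_add(1)[OF d ideal_scaleC(1)[OF ideal_rank_one(1)], of c \<xi> \<eta>]
    ideal_add(1)[OF ideal_rank_one(1) ideal_rank_one(1), of a \<eta> \<xi> b]
  show "x \<in> X" unfolding x_eq by (rule ideal_add(1)[OF mem])
  show "slope (rank_one \<xi> \<eta>) x \<le> slope (rank_one \<xi> \<eta>) d + Re c"
    using slope_add_le[OF \<xi> \<eta> mem]
      slope_add_le[OF \<xi> \<eta> d ideal_scaleC(1)[OF ideal_rank_one(1)], of c \<xi> \<eta>]
      slope_add_le[OF \<xi> \<eta> ideal_rank_one(1) ideal_rank_one(1), of a \<eta> \<xi> b]
      slope_rank_one_left_le[OF \<xi> \<eta> a] slope_rank_one_right_le[OF \<xi> \<eta> b] slope_multiple_le[OF \<xi> \<eta>, of c]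
    unfolding x_eq by linarith
qed

text \<open>
  Sublinearity gives one inequality; the other is the same inequality with \<open>x\<close> and \<open>d\<close>
  exchanged, since the perturbation may be subtracted again.
\<close>

lemma slope_perturb_eq:
  assumes \<xi>: "norm \<xi> = 1" and \<eta>: "norm \<eta> = 1" and d: "d \<in> X"
    and a: "cinner a \<xi> = 0" and b: "cinner b \<eta> = 0"
    and x: "\<And>u. x u = d u + c *\<^sub>C rank_one \<xi> \<eta> u + (rank_one a \<eta> u + rank_one \<xi> b u)"
  shows "slope (rank_one \<xi> \<eta>) x = slope (rank_one \<xi> \<eta>) d + Re c"
proof (rule antisym)
  note fwd = slope_perturb_le[OF \<xi> \<eta> d a b x]
  show "slope (rank_one \<xi> \<eta>) x \<le> slope (rank_one \<xi> \<eta>) d + Re c" by (rule fwd(2))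
  have "slope (rank_one \<xi> \<eta>) d \<le> slope (rank_one \<xi> \<eta>) x + Re (- c)"
  proof (rule slope_perturb_le(2)[OF \<xi> \<eta> fwd(1), where a = "- a" and b = "- b"])
    show "d u = x u + (- c) *\<^sub>C rank_one \<xi> \<eta> u + (rank_one (- a) \<eta> u + rank_one \<xi> (- b) u)" for u
      by (simp add: x rank_one_def cinner_minus_right)
  qed (simp_all add: a b cinner_minus_left)
  then show "slope (rank_one \<xi> \<eta>) d + Re c \<le> slope (rank_one \<xi> \<eta>) x" by simp
qed

text \<open>
  The reflection in \<open>\<xi>\<close> acting from the left fixes the rank one operator and negates \<open>d\<close>, whose
  range is orthogonal to \<open>\<xi>\<close>.
\<close>

lemma slope_uminus_le:
  assumes \<xi>: "norm \<xi> = 1" and \<eta>: "norm \<eta> = 1" and d: "d \<in> X" and orth: "\<And>u. cinner (d u) \<xi> = 0"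
  shows "slope (rank_one \<xi> \<eta>) (\<lambda>u. - d u) \<le> slope (rank_one \<xi> \<eta>) d"
proof -
  have md: "(\<lambda>u. - d u) \<in> X" using ideal_scaleC(1)[OF d, of "-1"] by simp
  have "excess (rank_one \<xi> \<eta>) (\<lambda>u. - d u) n \<le> excess (rank_one \<xi> \<eta>) d n" for n
  proof -
    have "(\<lambda>u. - d u + complex_of_real (real n) *\<^sub>C rank_one \<xi> \<eta> u)
        = (\<lambda>u. reflection \<xi> (d u + complex_of_real (real n) *\<^sub>C rank_one \<xi> \<eta> u))"
    proof
      fix u
      define k where "k = complex_of_real (real n) * cinner u \<eta>"
      have shift: "complex_of_real (real n) *\<^sub>C rank_one \<xi> \<eta> u = k *\<^sub>C \<xi>"
        by (simp add: rank_one_def scaleC_scaleC k_def)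
      have "cinner (d u + k *\<^sub>C \<xi>) \<xi> = k" by (simp add: cinner_simps orth cinner_self_eq_1[OF \<xi>])
      moreover have "(2 * k) *\<^sub>C \<xi> = k *\<^sub>C \<xi> + k *\<^sub>C \<xi>"
        using scaleC_add_left[of k k \<xi>] by (simp only: mult_2)
      ultimately show "- d u + complex_of_real (real n) *\<^sub>C rank_one \<xi> \<eta> u
          = reflection \<xi> (d u + complex_of_real (real n) *\<^sub>C rank_one \<xi> \<eta> u)"
        unfolding shift reflection_def by simp
    qed
    then show ?thesis
      using ideal_reflection[OF ideal_add(1)[OF d ideal_scaleC(1)[OF ideal_rank_one(1)]] \<xi>]
      by (simp add: excess_def)
  qed
  then show ?thesis
    by (intro LIMSEQ_le[OF excess_tendsto_slope[OF \<xi> \<eta> md] excess_tendsto_slope[OF \<xi> \<eta> d]]) auto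
qed

text \<open>
  The coefficient of \<open>x\<close> at \<open>\<eta>\<close> and \<open>\<xi>\<close> can be read off from norms. Here
  \<open>x\<close> is split into its corner \<open>c\<close>, the rest \<open>a\<close> of its first column, the rest \<open>b\<close> of its first
  row, and the remaining block \<open>d\<close>. The corner contributes its real part to the slope, \<open>a\<close> and
  \<open>b\<close> contribute nothing, and \<open>d\<close> contributes equally to the slopes of \<open>x\<close> and \<open>- x\<close>.
\<close>

lemma slope_odd_part:
  assumes \<xi>: "norm \<xi> = 1" and \<eta>: "norm \<eta> = 1" and x: "x \<in> X"
  shows "slope (rank_one \<xi> \<eta>) x - slope (rank_one \<xi> \<eta>) (\<lambda>u. - x u) = 2 * Re (cinner (x \<eta>) \<xi>)"
proof -
  obtain s e f where sch: "schmidt x s e f" using schmidt_decomposition[OF ideal_compact[OF x]] by blast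
  obtain x' where sch': "schmidt x' s f e"
    using schmidt_operator_exists[OF schmidt_orthonormal(2,1)[OF sch] schmidt_decseq[OF sch] schmidt_tendsto_0[OF sch]]
    by blast
  have adj: "cinner (x u) v = cinner u (x' v)" for u v by (rule schmidt_adjoint[OF sch sch'])
  note unit = cinner_self_eq_1[OF \<xi>] cinner_self_eq_1[OF \<eta>]
  define c where "c = cinner (x \<eta>) \<xi>"
  define a where "a = x \<eta> - c *\<^sub>C \<xi>"
  define b where "b = x' \<xi> - cnj c *\<^sub>C \<eta>"
  define d where "d u = x u + (- c) *\<^sub>C rank_one \<xi> \<eta> u + (rank_one (- a) \<eta> u + rank_one \<xi> (- b) u)" for u
  have a: "cinner a \<xi> = 0" by (simp add: a_def c_def cinner_simps unit)
  have "cinner \<eta> b = 0" by (simp add: b_def c_def cinner_simps unit adj)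
  then have b: "cinner b \<eta> = 0" by (simp add: cinner_eq_0_commute)
  have d: "d \<in> X"
    by (rule slope_perturb_le(1)[OF \<xi> \<eta> x, of "- a" "- b" _ "- c"])
      (simp_all add: d_def a b cinner_minus_left)
  have orth: "cinner (d u) \<xi> = 0" for u
    using a by (simp add: d_def rank_one_def cinner_simps unit adj b_def)
  have md: "(\<lambda>u. - d u) \<in> X" using ideal_scaleC(1)[OF d, of "-1"] by simp
  have "slope (rank_one \<xi> \<eta>) x = slope (rank_one \<xi> \<eta>) d + Re c"
    by (rule slope_perturb_eq[OF \<xi> \<eta> d a b]) (simp add: d_def rank_one_def cinner_minus_right)
  moreover have "slope (rank_one \<xi> \<eta>) (\<lambda>u. - x u) = slope (rank_one \<xi> \<eta>) (\<lambda>u. - d u) + Re (- c)"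
    by (rule slope_perturb_eq[OF \<xi> \<eta> md, of "- a" "- b"])
      (simp_all add: d_def rank_one_def cinner_minus_right cinner_minus_left a b)
  moreover have "slope (rank_one \<xi> \<eta>) (\<lambda>u. - d u) = slope (rank_one \<xi> \<eta>) d"
    using slope_uminus_le[OF \<xi> \<eta> d orth] slope_uminus_le[OF \<xi> \<eta> md] orth
    by (simp add: cinner_minus_left)
  ultimately show ?thesis by (simp add: c_def)
qed

section \<open>Two-local isometries\<close>

lemma linear_isometry_on_affine:
  assumes W: "linear_isometry_on X \<nu> W" and x: "x \<in> X" and z: "z \<in> X"
  shows "\<nu> (\<lambda>u. c *\<^sub>C W x u + t *\<^sub>C W z u) = \<nu> (\<lambda>u. c *\<^sub>C x u + t *\<^sub>C z u)"
proof -
  note mem = ideal_scaleC(1)[OF x, of c] ideal_scaleC(1)[OF z, of t]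
  have "W (\<lambda>u. c *\<^sub>C x u + t *\<^sub>C z u) = (\<lambda>u. c *\<^sub>C W x u + t *\<^sub>C W z u)"
    using W x z mem by (simp add: linear_isometry_on_def)
  moreover have "\<nu> (W (\<lambda>u. c *\<^sub>C x u + t *\<^sub>C z u)) = \<nu> (\<lambda>u. c *\<^sub>C x u + t *\<^sub>C z u)"
    using W ideal_add(1)[OF mem] by (simp add: linear_isometry_on_def)
  ultimately show ?thesis by simp
qed

text \<open>
  Both sides have the same slopes in all directions, because the norms of \<open>c W x + n y\<close> and
  \<open>c W' x + n y\<close> are equal to that of \<open>c x + n z\<close>. The scalars \<open>c = 1\<close> and \<open>c = - \<i>\<close> recover the
  real and the imaginary part.
\<close>

lemma pairing_determined_by_preimage:
  assumes W: "linear_isometry_on X \<nu> W" and W': "linear_isometry_on X \<nu> W'"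
    and z: "z \<in> X" "W z = rank_one \<xi> \<eta>" "W' z = rank_one \<xi> \<eta>"
    and \<xi>: "norm \<xi> = 1" and \<eta>: "norm \<eta> = 1" and x: "x \<in> X"
  shows "cinner (W x \<eta>) \<xi> = cinner (W' x \<eta>) \<xi>"
proof -
  have mem: "W x \<in> X" "W' x \<in> X" using W W' x by (auto simp: linear_isometry_on_def)
  have same: "slope (rank_one \<xi> \<eta>) (\<lambda>u. c *\<^sub>C W x u) = slope (rank_one \<xi> \<eta>) (\<lambda>u. c *\<^sub>C W' x u)" for c
  proof -
    have "excess (rank_one \<xi> \<eta>) (\<lambda>u. c *\<^sub>C W x u) n = excess (rank_one \<xi> \<eta>) (\<lambda>u. c *\<^sub>C W' x u) n" for n
      using linear_isometry_on_affine[OF W x z(1), of c] linear_isometry_on_affine[OF W' x z(1), of c]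
      by (simp add: excess_def z)
    then have "excess (rank_one \<xi> \<eta>) (\<lambda>u. c *\<^sub>C W x u) = excess (rank_one \<xi> \<eta>) (\<lambda>u. c *\<^sub>C W' x u)"
      by blast
    then show ?thesis by (simp add: slope_def)
  qed
  have re: "Re (c * cinner (W x \<eta>) \<xi>) = Re (c * cinner (W' x \<eta>) \<xi>)" for c
    using slope_odd_part[OF \<xi> \<eta> ideal_scaleC(1)[OF mem(1), of c]]
      slope_odd_part[OF \<xi> \<eta> ideal_scaleC(1)[OF mem(2), of c]] same[of c] same[of "- c"]
    by (simp add: cinner_scaleC_left)
  show ?thesis using re[of 1] re[of "- \<i>"] by (simp add: complex_eq_iff)
qed

text \<open>
  Linearity can be tested on matrix coefficients, and on each of them \<open>V\<close> coincides with a
  linear isometry that does not depend on the argument.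
\<close>

theorem surjective_2_local_isometry_linear:
  assumes V: "surjective_2_local_isometry_on X \<nu> V"
  shows "linear_isometry_on X \<nu> V"
proof -
  have V_mem: "V x \<in> X" if "x \<in> X" for x
    using V that by (auto simp: surjective_2_local_isometry_on_def)
  have two_local: "\<exists>W. linear_isometry_on X \<nu> W \<and> V x = W x \<and> V z = W z" if "x \<in> X" "z \<in> X" for x z
  proof -
    have "\<forall>x\<in>X. \<forall>z\<in>X. \<exists>W. linear_isometry_on X \<nu> W \<and> W ` X = X \<and> V x = W x \<and> V z = W z"
      using V unfolding surjective_2_local_isometry_on_def by (rule conjunct2)
    from this[rule_format, OF that] show ?thesis by blast
  qed
  \<comment> \<open>every matrix coefficient of \<open>V\<close> agrees with that of a single linear isometry \<open>W\<close>,
    taken from the pair \<open>z, z\<close> where \<open>z\<close> is a preimage of the rank one operator\<close>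
  have model: "\<exists>W. linear_isometry_on X \<nu> W \<and> (\<forall>x\<in>X. cinner (V x \<eta>) \<xi> = cinner (W x \<eta>) \<xi>)"
    if \<xi>: "norm \<xi> = 1" and \<eta>: "norm \<eta> = 1" for \<xi> \<eta>
  proof -
    have "rank_one \<xi> \<eta> \<in> V ` X"
      using V ideal_rank_one(1) by (simp add: surjective_2_local_isometry_on_def)
    then obtain z where z: "z \<in> X" "V z = rank_one \<xi> \<eta>" by auto
    obtain W where W: "linear_isometry_on X \<nu> W" "W z = rank_one \<xi> \<eta>"
      using two_local[OF z(1) z(1)] z(2) by auto
    have "cinner (V x \<eta>) \<xi> = cinner (W x \<eta>) \<xi>" if x: "x \<in> X" for x
    proof -
      obtain W' where W': "linear_isometry_on X \<nu> W'" "V x = W' x" "V z = W' z"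
        using two_local[OF x z(1)] by blast
      have "W' z = rank_one \<xi> \<eta>" using W'(3) z(2) by simp
      from pairing_determined_by_preimage[where W = W' and W' = W and z = z, OF W'(1) W(1) z(1) this W(2) \<xi> \<eta> x]
      show ?thesis by (simp only: W'(2))
    qed
    then show ?thesis using W(1) by blast
  qed
  \<comment> \<open>operators are determined by their matrix coefficients\<close>
  have eqI: "x = y" if x: "x \<in> X" and y: "y \<in> X"
    and eq: "\<And>\<xi> \<eta>. norm \<xi> = 1 \<Longrightarrow> norm \<eta> = 1 \<Longrightarrow> cinner (x \<eta>) \<xi> = cinner (y \<eta>) \<xi>" for x y :: "'h \<Rightarrow> 'h"
  proof
    fix u
    have lin: "clinear x" "clinear y" using ideal_compact[OF x] ideal_compact[OF y] by (simp_all add: compact_clinear_def)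
    show "x u = y u"
    proof (cases "u = 0")
      case True
      then show ?thesis by (simp add: clinear_zero[OF lin(1)] clinear_zero[OF lin(2)])
    next
      case u: False
      show ?thesis
      proof (rule cinner_eqI)
        fix v
        show "cinner (x u) v = cinner (y u) v"
        proof (cases "v = 0")
          case False
          from eq[OF normalize_vector[OF False] normalize_vector[OF u]] show ?thesis
            using u False by (simp add: clinear_scaleC[OF lin(1)] clinear_scaleC[OF lin(2)] cinner_simps)
        qed simp
      qed
    qed
  qed
  show ?thesis
    unfolding linear_isometry_on_def
  proof (intro conjI ballI allI)
    show "V ` X \<subseteq> X" using V_mem by blast
    show "\<nu> (V x) = \<nu> x" if x: "x \<in> X" for x
    proof -
      obtain W where "linear_isometry_on X \<nu> W" "V x = W x" using two_local[OF x x] by blast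
      then show ?thesis using x by (simp add: linear_isometry_on_def)
    qed
    show "V (\<lambda>u. x u + y u) = (\<lambda>u. V x u + V y u)" if x: "x \<in> X" and y: "y \<in> X" for x y
    proof (rule eqI[OF V_mem[OF ideal_add(1)[OF x y]] ideal_add(1)[OF V_mem[OF x] V_mem[OF y]]])
      fix \<xi> \<eta> :: 'h assume "norm \<xi> = 1" "norm \<eta> = 1"
      then obtain W where W: "linear_isometry_on X \<nu> W"
          "\<And>x. x \<in> X \<Longrightarrow> cinner (V x \<eta>) \<xi> = cinner (W x \<eta>) \<xi>" using model by metis
      have "W (\<lambda>u. x u + y u) = (\<lambda>u. W x u + W y u)" using W(1) x y by (simp add: linear_isometry_on_def)
      then show "cinner (V (\<lambda>u. x u + y u) \<eta>) \<xi> = cinner (V x \<eta> + V y \<eta>) \<xi>"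
        by (simp add: W(2)[OF ideal_add(1)[OF x y]] W(2)[OF x] W(2)[OF y] cinner_add_left)
    qed
    show "V (\<lambda>u. c *\<^sub>C x u) = (\<lambda>u. c *\<^sub>C V x u)" if x: "x \<in> X" for c x
    proof (rule eqI[OF V_mem[OF ideal_scaleC(1)[OF x]] ideal_scaleC(1)[OF V_mem[OF x]]])
      fix \<xi> \<eta> :: 'h assume "norm \<xi> = 1" "norm \<eta> = 1"
      then obtain W where W: "linear_isometry_on X \<nu> W"
          "\<And>x. x \<in> X \<Longrightarrow> cinner (V x \<eta>) \<xi> = cinner (W x \<eta>) \<xi>" using model by metis
      have "W (\<lambda>u. c *\<^sub>C x u) = (\<lambda>u. c *\<^sub>C W x u)" using W(1) x by (simp add: linear_isometry_on_def)
      then show "cinner (V (\<lambda>u. c *\<^sub>C x u) \<eta>) \<xi> = cinner (c *\<^sub>C V x \<eta>) \<xi>"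
        by (simp add: W(2)[OF ideal_scaleC(1)[OF x]] W(2)[OF x] cinner_scaleC_left)
    qed
  qed
qed

end

theorem theorem9:
  fixes E :: "(nat \<Rightarrow> real) set"
    and N :: "(nat \<Rightarrow> real) \<Rightarrow> real"
    and V :: "('h::complex_hilbert \<Rightarrow> 'h) \<Rightarrow> ('h \<Rightarrow> 'h)"
  assumes "separable_space (euclidean :: 'h topology)"
    and "\<not> (\<exists>B :: 'h set. finite B \<and> complex_vector.span B = UNIV)"
    and "banach_symmetric_seq_space E N"
    and "E \<subseteq> c_zero"
    and "fatou_property E N"
    and "\<not> is_l2 E N"
    and "surjective_2_local_isometry_on (symmetric_ideal E) (symmetric_ideal_norm N) V"
  shows "linear_isometry_on (symmetric_ideal E) (symmetric_ideal_norm N) V"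
proof -
  interpret fatou_ideal "TYPE('h)" E N
    using assms(2,3,5) by unfold_locales
  show ?thesis by (rule surjective_2_local_isometry_linear[OF assms(7)])
qed

end
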